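(* The following separation problem is decidable. INSTANCE: A list of MV-terms $\tau_1,\ldots,\tau_k$ in the variables $X_1,\ldots,X_n$. QUESTION: Does the set of functions $\{\hat\tau_1,\ldots,\hat\tau_k\}$ separate points of $[0,1]^n$?
   Context: An MV-term $\tau=\tau(X_1,\ldots,X_n)$ is a string of symbols obtained from the variable symbols $X_i$ and the constant symbol $0$ by finitely many applications of the MV-algebraic connectives $\neg,\oplus$. The map $\hat{}$ sending $X_i$ to the $i$th coordinate function $\pi_i\colon[0,1]^n\to[0,1]$ canonically extends to a map interpreting each MV-term $\tau(X_1,\ldots,X_n)$ as a McNaughton function $\hat\tau$ in the free $n$-generator MV-algebra $\mathcal M([0,1]^n)$ of all $n$-variable McNaughton functions on $[0,1]^n$ (continuous piecewise linear functions $[0,1]^n\to[0,1]$ each of whose linear pieces has integer coefficients). A set $S$ of functions on $[0,1]^n$ separates points of $[0,1]^n$ if for all $x\neq y$ in $[0,1]^n$ there is $f\in S$ with $f(x)\neq f(y)$. Decidable means Turing-decidable. *)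

theory Defs
  imports Complex_Main "HOL-Library.FuncSet"
begin

section \<open>MV-terms and the functions they denote\<close>

text \<open>\<open>Var i\<close> is the variable symbol $X_i$; variables are numbered from 1.\<close>

datatype mvterm = Var nat | Zero | Neg mvterm | Oplus mvterm mvterm

primrec vars :: "mvterm \<Rightarrow> nat set" where
  "vars (Var i) = {i}"
| "vars Zero = {}"
| "vars (Neg t) = vars t"
| "vars (Oplus s t) = vars s \<union> vars t"

definition cube :: "nat \<Rightarrow> (nat \<Rightarrow> real) set" where
  "cube n = {1..n} \<rightarrow>\<^sub>E {0..1}"

text \<open>
  The MV-algebra of all McNaughton functions carries the pointwise operations of the standard
  MV-algebra $[0,1]$. Only the values of \<open>interp t\<close> on \<open>cube n\<close>, for \<open>vars t \<subseteq> {1..n}\<close>, are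
  meaningful.
\<close>

primrec interp :: "mvterm \<Rightarrow> (nat \<Rightarrow> real) \<Rightarrow> real" where
  "interp (Var i) = (\<lambda>x. x i)"
| "interp Zero = (\<lambda>x. 0)"
| "interp (Neg t) = (\<lambda>x. 1 - interp t x)"
| "interp (Oplus s t) = (\<lambda>x. min 1 (interp s x + interp t x))"

definition separates_points :: "('a \<Rightarrow> 'b) set \<Rightarrow> 'a set \<Rightarrow> bool" where
  "separates_points S A \<longleftrightarrow> (\<forall>x\<in>A. \<forall>y\<in>A. x \<noteq> y \<longrightarrow> (\<exists>f\<in>S. f x \<noteq> f y))"


section \<open>Turing-decidable languages\<close>

text \<open>
  Deterministic machines with one two-way infinite tape. The tape alphabet consists of the blank,
  the letters of the finite input alphabet \<open>'a\<close>, and finitely many auxiliary symbols.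
\<close>

datatype 'a cell = Blank | Letter 'a | Aux nat

datatype move = Left | Stay | Right

record 'a turing_machine =
  states :: "nat set"
  aux_symbols :: "nat set"
  transition :: "nat \<Rightarrow> 'a cell \<Rightarrow> nat \<times> 'a cell \<times> move"
  start_state :: nat
  accept_state :: nat
  reject_state :: nat

definition tape_alphabet :: "'a turing_machine \<Rightarrow> 'a cell set" where
  "tape_alphabet M = insert Blank (range Letter \<union> Aux ` aux_symbols M)"

definition wf_machine :: "'a::finite turing_machine \<Rightarrow> bool" where
  "wf_machine M \<longleftrightarrow>
     finite (states M) \<and> finite (aux_symbols M) \<and>
     {start_state M, accept_state M, reject_state M} \<subseteq> states M \<and>
     accept_state M \<noteq> reject_state M \<and>
     (\<forall>q\<in>states M. \<forall>a\<in>tape_alphabet M.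
        transition M q a \<in> states M \<times> tape_alphabet M \<times> UNIV)"

text \<open>A configuration consists of the state, the head position and the tape contents.\<close>

type_synonym 'a config = "nat \<times> int \<times> (int \<Rightarrow> 'a cell)"

primrec offset :: "move \<Rightarrow> int" where
  "offset Left = -1"
| "offset Stay = 0"
| "offset Right = 1"

fun step :: "'a turing_machine \<Rightarrow> 'a config \<Rightarrow> 'a config" where
  "step M (q, h, t) =
     (if q = accept_state M \<or> q = reject_state M then (q, h, t)
      else (case transition M q (t h) of (q', a, d) \<Rightarrow> (q', h + offset d, t(h := a))))"

definition initial :: "'a turing_machine \<Rightarrow> 'a list \<Rightarrow> 'a config" where
  "initial M w =
     (start_state M, 0, \<lambda>i. if 0 \<le> i \<and> i < int (length w) then Letter (w ! nat i) else Blank)"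

definition accepts :: "'a turing_machine \<Rightarrow> 'a list \<Rightarrow> bool" where
  "accepts M w \<longleftrightarrow> (\<exists>k. fst ((step M ^^ k) (initial M w)) = accept_state M)"

definition rejects :: "'a turing_machine \<Rightarrow> 'a list \<Rightarrow> bool" where
  "rejects M w \<longleftrightarrow> (\<exists>k. fst ((step M ^^ k) (initial M w)) = reject_state M)"

definition turing_decidable :: "'a::finite list set \<Rightarrow> bool" where
  "turing_decidable L \<longleftrightarrow>
     (\<exists>M. wf_machine M \<and> (\<forall>w. (w \<in> L \<longrightarrow> accepts M w) \<and> (w \<notin> L \<longrightarrow> rejects M w)))"


section \<open>Instances as words over a finite alphabet\<close>

text \<open>
  Terms are written in prefix notation; numbers (the index of a variable and the dimension) are
  written in unary with the letter \<open>Tally\<close>. The dimension is part of an instance because it is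
  not determined by the variables that actually occur in the terms.
\<close>

datatype letter = Tally | Comma | VarSym | ZeroSym | NegSym | OplusSym

instance letter :: finite
proof
  have "(UNIV :: letter set) = {Tally, Comma, VarSym, ZeroSym, NegSym, OplusSym}"
    using letter.exhaust by auto
  then show "finite (UNIV :: letter set)"
    by (rule ssubst) simp
qed

primrec encode_term :: "mvterm \<Rightarrow> letter list" where
  "encode_term (Var i) = VarSym # replicate i Tally"
| "encode_term Zero = [ZeroSym]"
| "encode_term (Neg t) = NegSym # encode_term t"
| "encode_term (Oplus s t) = OplusSym # encode_term s @ encode_term t"

definition encode_instance :: "nat \<Rightarrow> mvterm list \<Rightarrow> letter list" where
  "encode_instance n ts = replicate n Tally @ concat (map (\<lambda>t. Comma # encode_term t) ts)"

lemma replicate_append_unique: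
  assumes "replicate i a @ u = replicate j a @ v" "take 1 u \<noteq> [a]" "take 1 v \<noteq> [a]"
  shows "i = j \<and> u = v"
  using assms
proof (induction i arbitrary: j)
  case 0
  then show ?case by (cases j) simp_all
next
  case (Suc i)
  from Suc.prems(1,3) obtain j' where j: "j = Suc j'"
    by (cases j) auto
  with Suc.prems(1) have "replicate i a @ u = replicate j' a @ v"
    by simp
  from Suc.IH[OF this Suc.prems(2,3)] j show ?case by simp
qed

lemma take_encode_term: "take 1 (encode_term t @ u) \<noteq> [Tally]"
  by (cases t) auto

lemma encode_term_append_unique:
  assumes "encode_term s @ u = encode_term t @ v" "take 1 u \<noteq> [Tally]" "take 1 v \<noteq> [Tally]"
  shows "s = t \<and> u = v"
  using assms
proof (induction s arbitrary: t u v)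
  case (Var i)
  from Var.prems(1) obtain j where t: "t = Var j"
    by (cases t) simp_all
  with Var.prems(1) have "replicate i Tally @ u = replicate j Tally @ v"
    by simp
  from replicate_append_unique[OF this Var.prems(2,3)] t show ?case by simp
next
  case Zero
  then show ?case by (cases t) simp_all
next
  case (Neg s)
  from Neg.prems(1) obtain t' where t: "t = Neg t'"
    by (cases t) simp_all
  with Neg.prems(1) have "encode_term s @ u = encode_term t' @ v"
    by simp
  from Neg.IH[OF this Neg.prems(2,3)] t show ?case by simp
next
  case (Oplus s1 s2)
  from Oplus.prems(1) obtain t1 t2 where t: "t = Oplus t1 t2"
    by (cases t) simp_all
  with Oplus.prems(1) have "encode_term s1 @ encode_term s2 @ u = encode_term t1 @ encode_term t2 @ v"
    by simp
  from Oplus.IH(1)[OF this take_encode_term take_encode_term]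
  have "s1 = t1" and "encode_term s2 @ u = encode_term t2 @ v" by simp_all
  with Oplus.IH(2)[OF _ Oplus.prems(2,3)] t show ?case by simp
qed

lemma take_encode_terms: "take 1 (concat (map (\<lambda>t. Comma # encode_term t) ts)) \<noteq> [Tally]"
  by (cases ts) auto

lemma encode_terms_inject:
  assumes "concat (map (\<lambda>t. Comma # encode_term t) ss) = concat (map (\<lambda>t. Comma # encode_term t) ts)"
  shows "ss = ts"
  using assms
proof (induction ss arbitrary: ts)
  case Nil
  then show ?case by (cases ts) auto
next
  case (Cons s ss)
  from Cons.prems obtain t ts' where ts: "ts = t # ts'"
    by (cases ts) auto
  with Cons.prems
  have "encode_term s @ concat (map (\<lambda>t. Comma # encode_term t) ss) =
        encode_term t @ concat (map (\<lambda>t. Comma # encode_term t) ts')"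
    by simp
  from encode_term_append_unique[OF this take_encode_terms take_encode_terms]
  show ?case using Cons.IH[of ts'] ts by simp
qed

text \<open>Distinct instances have distinct codes, so the language below represents the problem.\<close>

lemma encode_instance_inject:
  "encode_instance m ss = encode_instance n ts \<longleftrightarrow> m = n \<and> ss = ts"
proof
  assume "encode_instance m ss = encode_instance n ts"
  from replicate_append_unique[OF this[unfolded encode_instance_def] take_encode_terms take_encode_terms]
  show "m = n \<and> ss = ts"
    using encode_terms_inject[of ss ts] by simp
qed simp

definition separation_problem :: "letter list set" where
  "separation_problem =
     {encode_instance n ts | n ts.
        (\<forall>t\<in>set ts. vars t \<subseteq> {1..n}) \<and> separates_points (interp ` set ts) (cube n)}"

end

theory Submission
  imports Defs "HOL-Library.Countable_Set"
begin

text \<open>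
  A failure of separation is a solution of a system of linear inequalities: given \<open>x \<noteq> y\<close> with equal
  values, fix the outcome of every truncation in every term as it is at \<open>x\<close> and at \<open>y\<close>.
  Fourier--Motzkin elimination turns this real solution into a rational one with a common
  denominator \<open>D\<close> bounded in terms of the length of the instance. So it suffices to
  search the finitely many pairs of points with coordinates in \<open>{0, 1/D, \<dots>, 1}\<close>, where
  terms are evaluated in the finite chain \<open>{0..D}\<close>. The search is expressed by primitive recursion,
  hence carried out by a counter machine, whose unary counters a Turing machine keeps on the
  tracks of its tape.
\<close>

section \<open>Counter machines on Turing machines\<close>

text \<open>The denominator needs a computable bound, although elimination may square the number of
  constraints for every variable. The bound is blind to that number: back substitution divides by
  one coefficient at a time, and \<open>fact K\<close> is a multiple of every positive integer up to
  \<open>K\<close>, whichever constraint supplies it. Only the number of unknowns and the growth of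
  the coefficients count, and the latter start out below a power of 2 in the length of a term. The
  condition that x and y differ is not linear. With a coordinate and an order chosen it is one
  strict inequality, so strictness is carried along through the elimination. A decider must also
  reject words that code no instance. Stack evaluation in prefix notation serves both purposes: the
  depth of the stack checks the syntax, its values answer the question. Running time is irrelevant,
  so unary counters and exhaustive search suffice.\<close>

definition reaches :: "('s \<Rightarrow> 's) \<Rightarrow> 's \<Rightarrow> 's \<Rightarrow> bool" where
  "reaches f x y \<longleftrightarrow> (\<exists>j. (f ^^ j) x = y)"

lemma reaches_refl: "reaches f x x"
  unfolding reaches_def by (rule exI[of _ 0]) simp

lemma reaches_step: "reaches f (f x) y \<Longrightarrow> reaches f x y"
  unfolding reaches_def by (metis funpow_Suc_right comp_apply)

lemma reaches_step_eq: "f x = y \<Longrightarrow> reaches f y z \<Longrightarrow> reaches f x z"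
  using reaches_step by metis

lemma reaches_trans: "reaches f x y \<Longrightarrow> reaches f y z \<Longrightarrow> reaches f x z"
  unfolding reaches_def by (metis funpow_add comp_apply)

datatype action = Inc | Dec | Nop

fun act_on :: "action \<Rightarrow> nat \<Rightarrow> (nat \<Rightarrow> nat) \<Rightarrow> nat \<Rightarrow> nat" where
  "act_on Inc r s = s(r := Suc (s r))"
| "act_on Dec r s = s(r := s r - 1)"
| "act_on Nop r s = s"

definition letter_at :: "'a list \<Rightarrow> nat \<Rightarrow> 'a option" where
  "letter_at w i = (if i < length w then Some (w ! i) else None)"

text \<open>The successor depends on the zero test of the selected counter and on the input letter
  at the position which that counter denotes. Counters are thus also the pointers into the read-only
  input.\<close>

locale counter_control =
  fixes reg :: "'q \<Rightarrow> nat"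
    and act :: "'q \<Rightarrow> action"
    and succ :: "'q \<Rightarrow> bool \<Rightarrow> 'a::finite option \<Rightarrow> 'q"
    and acc rej :: 'q
begin

fun counter_step :: "'a list \<Rightarrow> 'q \<times> (nat \<Rightarrow> nat) \<Rightarrow> 'q \<times> (nat \<Rightarrow> nat)" where
  "counter_step w (q, s) =
     (if q = acc \<or> q = rej then (q, s)
      else (succ q (s (reg q) = 0) (letter_at w (s (reg q))), act_on (act q) (reg q) s))"

end

datatype 'q phase = Start | Go 'q | Unmark nat 'q | Back 'q

text \<open>
  Counter \<open>r\<close> is kept in unary on its own track: the cells \<open>0, \<dots>, s r - 1\<close> are marked with \<open>r\<close>.
  A symbol consists of the flag of cell 0, the input letter, and the set of marks.
\<close>

type_synonym 'a sym = "bool \<times> 'a option \<times> nat set"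

locale counter_machine = counter_control reg act succ acc rej
  for reg :: "'q \<Rightarrow> nat" and act :: "'q \<Rightarrow> action"
    and succ :: "'q \<Rightarrow> bool \<Rightarrow> 'a::finite option \<Rightarrow> 'q" and acc rej :: 'q +
  fixes Q :: "'q set" and k :: nat and q0 :: 'q
  assumes finite_Q: "finite Q"
    and special: "q0 \<in> Q" "acc \<in> Q" "rej \<in> Q" "acc \<noteq> rej"
    and reg_less: "q \<in> Q \<Longrightarrow> reg q < k"
    and succ_closed: "q \<in> Q \<Longrightarrow> succ q z a \<in> Q"
begin

text \<open>One counter instruction is one excursion from cell 0. \<open>Go q\<close> runs right to
  the first cell without the mark \<open>reg q\<close>; its position is the value of the counter, so
  the flag found there is the zero test and the letter found there is the one pointed at. The last
  mark lies one cell further left, hence the extra phase \<open>Unmark\<close>, which carries the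
  successor already chosen. \<open>Start\<close> sets the flag by which \<open>Back\<close>
  recognises cell 0.\<close>

fun delta :: "'q phase \<Rightarrow> 'a sym \<Rightarrow> 'q phase \<times> 'a sym \<times> move" where
  "delta Start (h, a, m) = (Go q0, (True, a, m), Stay)"
| "delta (Go q) (h, a, m) =
     (if reg q \<in> m then (Go q, (h, a, m), Right)
      else case act q of
        Inc \<Rightarrow> (Back (succ q h a), (h, a, insert (reg q) m), Stay)
      | Dec \<Rightarrow> (if h then (Back (succ q h a), (h, a, m), Stay)
                else (Unmark (reg q) (succ q h a), (h, a, m), Left))
      | Nop \<Rightarrow> (Back (succ q h a), (h, a, m), Stay))"
| "delta (Unmark r q) (h, a, m) = (Back q, (h, a, m - {r}), Stay)"
| "delta (Back q) (h, a, m) = (if h then (Go q, (h, a, m), Stay) else (Back q, (h, a, m), Left))"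

definition phases :: "'q phase set" where
  "phases = insert Start (Go ` Q \<union> (\<lambda>(r, q). Unmark r q) ` ({..<k} \<times> Q) \<union> Back ` Q)"

definition syms :: "'a sym set" where
  "syms = UNIV \<times> UNIV \<times> Pow {..<k}"

lemma finite_phases: "finite phases"
  unfolding phases_def using finite_Q by auto

lemma finite_syms: "finite syms"
  unfolding syms_def by auto

lemma delta_closed:
  assumes "p \<in> phases" "c \<in> syms"
  shows "delta p c \<in> phases \<times> syms \<times> UNIV"
proof -
  obtain h a m where c: "c = (h, a, m)" by (cases c)
  with assms(2) have m: "m \<subseteq> {..<k}" by (simp add: syms_def)
  show ?thesis
    using assms(1) m special reg_less succ_closed
    by (cases p) (auto simp: c phases_def syms_def split: action.split)
qed

definition enc_phase :: "'q phase \<Rightarrow> nat" where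
  "enc_phase = to_nat_on phases"

lemma dec_enc_phase: "p \<in> phases \<Longrightarrow> from_nat_into phases (enc_phase p) = p"
  unfolding enc_phase_def using finite_phases by (simp add: countable_finite)

definition enc_sym :: "'a sym \<Rightarrow> 'a cell" where
  "enc_sym c = Aux (to_nat_on syms c)"

fun dec_sym :: "'a cell \<Rightarrow> 'a sym" where
  "dec_sym Blank = (False, None, {})"
| "dec_sym (Letter a) = (False, Some a, {})"
| "dec_sym (Aux j) = from_nat_into syms j"

lemma dec_enc_sym: "c \<in> syms \<Longrightarrow> dec_sym (enc_sym c) = c"
  unfolding enc_sym_def using finite_syms by (simp add: countable_finite)

definition tm :: "'a turing_machine" where
  "tm = \<lparr>states = enc_phase ` phases, aux_symbols = to_nat_on syms ` syms,
     transition = (\<lambda>q c. case delta (from_nat_into phases q) (dec_sym c) of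
       (p, c', d) \<Rightarrow> (enc_phase p, enc_sym c', d)),
     start_state = enc_phase Start, accept_state = enc_phase (Go acc),
     reject_state = enc_phase (Go rej)\<rparr>"

lemma dec_sym_in_syms: "c \<in> tape_alphabet tm \<Longrightarrow> dec_sym c \<in> syms"
  using finite_syms
  by (auto simp: tape_alphabet_def tm_def countable_finite) (auto simp: syms_def)

lemma special_phases: "Start \<in> phases" "Go acc \<in> phases" "Go rej \<in> phases"
  using special by (auto simp: phases_def)

lemma enc_phase_eq_iff: "p \<in> phases \<Longrightarrow> p' \<in> phases \<Longrightarrow> enc_phase p = enc_phase p' \<longleftrightarrow> p = p'"
  using dec_enc_phase by metis

lemma wf_tm: "wf_machine tm"
proof -
  have "transition tm q c \<in> states tm \<times> tape_alphabet tm \<times> UNIV"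
    if "q \<in> states tm" "c \<in> tape_alphabet tm" for q c
  proof -
    from that(1) obtain p where p: "p \<in> phases" "q = enc_phase p"
      by (auto simp: tm_def)
    have "delta p (dec_sym c) \<in> phases \<times> syms \<times> UNIV"
      using delta_closed p(1) dec_sym_in_syms[OF that(2)] .
    then show ?thesis
      using p by (auto simp: tm_def tape_alphabet_def enc_sym_def dec_enc_phase split: prod.split)
  qed
  moreover have "{start_state tm, accept_state tm, reject_state tm} \<subseteq> states tm"
    using special_phases by (simp add: tm_def)
  moreover have "accept_state tm \<noteq> reject_state tm"
    using special_phases special(4) by (simp add: tm_def enc_phase_eq_iff)
  moreover have "finite (states tm)" "finite (aux_symbols tm)"
    using finite_phases finite_syms by (auto simp: tm_def)
  ultimately show ?thesis
    unfolding wf_machine_def by blast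
qed

section \<open>Simulation of the counter machine on decoded tapes\<close>

fun phase_step :: "'q phase \<times> int \<times> (int \<Rightarrow> 'a sym) \<Rightarrow> 'q phase \<times> int \<times> (int \<Rightarrow> 'a sym)" where
  "phase_step (p, h, T) =
     (if p = Go acc \<or> p = Go rej then (p, h, T)
      else case delta p (T h) of (p', c, d) \<Rightarrow> (p', h + offset d, T(h := c)))"

text \<open>The tape is related by decoding because one symbol can have several raw forms: a blank
  and the code of \<open>(False, None, {})\<close> decode alike.\<close>

fun represents :: "'a config \<Rightarrow> 'q phase \<times> int \<times> (int \<Rightarrow> 'a sym) \<Rightarrow> bool" where
  "represents (q, h, t) (p, h', T) \<longleftrightarrow>
     p \<in> phases \<and> q = enc_phase p \<and> h = h' \<and> T = dec_sym \<circ> t \<and> (\<forall>i. T i \<in> syms)"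

lemma represents_step:
  assumes "represents x y"
  shows "represents (step tm x) (phase_step y)"
proof -
  obtain q h t where x: "x = (q, h, t)" by (cases x)
  obtain p h' T where y: "y = (p, h', T)" by (cases y)
  from assms have R: "p \<in> phases" "q = enc_phase p" "h' = h" "T = dec_sym \<circ> t" "\<forall>i. T i \<in> syms"
    by (auto simp: x y)
  have halt: "q = accept_state tm \<longleftrightarrow> p = Go acc" "q = reject_state tm \<longleftrightarrow> p = Go rej"
    using R special_phases by (auto simp: tm_def enc_phase_eq_iff)
  obtain p' c d where d: "delta p (T h) = (p', c, d)" by (cases "delta p (T h)")
  have "T h \<in> syms" using R(5) by auto
  with delta_closed[OF R(1) this] d have cl: "p' \<in> phases" "c \<in> syms" by auto
  have tr: "transition tm q (t h) = (enc_phase p', enc_sym c, d)"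
    using d R by (simp add: tm_def dec_enc_phase)
  have "(dec_sym \<circ> t)(h := c) = dec_sym \<circ> t(h := enc_sym c)"
    using cl by (auto simp: dec_enc_sym)
  then show ?thesis
    using R halt d tr cl by (auto simp: x y dec_enc_sym split: if_splits)
qed

lemma represents_funpow:
  "represents x y \<Longrightarrow> represents ((step tm ^^ j) x) ((phase_step ^^ j) y)"
  by (induction j) (auto intro: represents_step)

definition tape :: "'a list \<Rightarrow> (nat \<Rightarrow> nat) \<Rightarrow> int \<Rightarrow> 'a sym" where
  "tape w s i =
     (i = 0, if 0 \<le> i then letter_at w (nat i) else None, {r. r < k \<and> 0 \<le> i \<and> i < int (s r)})"

lemma walk_right:
  assumes "q \<in> Q" "q \<noteq> acc" "q \<noteq> rej" "j \<le> s (reg q)"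
  shows "reaches phase_step (Go q, 0, tape w s) (Go q, int j, tape w s)"
  using assms(4)
proof (induction j)
  case 0
  then show ?case by (simp add: reaches_refl)
next
  case (Suc j)
  have "phase_step (Go q, int j, tape w s) = (Go q, int (Suc j), tape w s)"
    using assms(1-3) Suc.prems reg_less[of q] by (auto simp: tape_def fun_eq_iff)
  then have "reaches phase_step (Go q, int j, tape w s) (Go q, int (Suc j), tape w s)"
    by (rule reaches_step_eq[OF _ reaches_refl])
  from reaches_trans[OF Suc.IH this] Suc.prems show ?case by simp
qed

lemma walk_left: "reaches phase_step (Back q, int j, tape w s) (Go q, 0, tape w s)"
proof (induction j)
  case 0
  have "phase_step (Back q, int 0, tape w s) = (Go q, 0, tape w s)"
    by (auto simp: tape_def fun_eq_iff)
  then show ?case by (rule reaches_step_eq[OF _ reaches_refl])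
next
  case (Suc j)
  have "phase_step (Back q, int (Suc j), tape w s) = (Back q, int j, tape w s)"
    by (auto simp: tape_def fun_eq_iff)
  then show ?case using Suc by (rule reaches_step_eq)
qed

lemma simulate_step:
  assumes "q \<in> Q" "counter_step w (q, s) = (q', s')"
  shows "reaches phase_step (Go q, 0, tape w s) (Go q', 0, tape w s')"
proof (cases "q = acc \<or> q = rej")
  case True
  with assms show ?thesis by (auto intro: reaches_refl)
next
  case False
  define r where "r = reg q"
  have r: "r < k" using assms(1) reg_less by (simp add: r_def)
  have q': "q' = succ q (s r = 0) (letter_at w (s r))" and s': "s' = act_on (act q) r s"
    using assms(2) False by (auto simp: r_def)
  have right: "reaches phase_step (Go q, 0, tape w s) (Go q, int (s r), tape w s)"
    using walk_right[OF assms(1), of "s r" s w] False by (simp add: r_def)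
  have "reaches phase_step (Go q, int (s r), tape w s) (Go q', 0, tape w s')"
  proof (cases "act q")
    case Inc
    have "phase_step (Go q, int (s r), tape w s) = (Back q', int (s r), tape w s')"
      using False Inc r by (auto simp: q' s' r_def[symmetric] tape_def fun_eq_iff)
    then show ?thesis by (rule reaches_step_eq[OF _ walk_left])
  next
    case Nop
    have "phase_step (Go q, int (s r), tape w s) = (Back q', int (s r), tape w s')"
      using False Nop r by (auto simp: q' s' r_def[symmetric] tape_def fun_eq_iff)
    then show ?thesis by (rule reaches_step_eq[OF _ walk_left])
  next
    case Dec
    show ?thesis
    proof (cases "s r")
      \<comment> \<open>At zero the truncated subtraction in \<open>act_on Dec\<close> changes
        nothing, and the flag keeps the head from leaving cell 0 to the left.\<close>
      case 0
      then have "phase_step (Go q, int (s r), tape w s) = (Back q', int 0, tape w s')"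
        using False Dec r by (auto simp: q' s' r_def[symmetric] tape_def fun_eq_iff)
      then show ?thesis by (rule reaches_step_eq[OF _ walk_left])
    next
      case (Suc j)
      have nat_1j: "nat (1 + int j) = Suc j" by simp
      have 1: "phase_step (Go q, int (s r), tape w s) = (Unmark r q', int j, tape w s)"
        using False Dec r Suc nat_1j by (auto simp: q' s' r_def[symmetric] tape_def fun_eq_iff)
      have 2: "phase_step (Unmark r q', int j, tape w s) = (Back q', int j, tape w s')"
        using Suc r Dec by (auto simp: s' tape_def fun_eq_iff)
      show ?thesis
        using reaches_step_eq[OF 1 reaches_step_eq[OF 2 walk_left]] .
    qed
  qed
  with right show ?thesis by (rule reaches_trans)
qed

lemma simulate:
  assumes "q \<in> Q"
  shows "fst ((counter_step w ^^ j) (q, s)) \<in> Q \<and>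
    reaches phase_step (Go q, 0, tape w s)
      (Go (fst ((counter_step w ^^ j) (q, s))), 0, tape w (snd ((counter_step w ^^ j) (q, s))))"
proof (induction j)
  case 0
  then show ?case using assms by (simp add: reaches_refl)
next
  case (Suc j)
  obtain q1 s1 where 1: "(counter_step w ^^ j) (q, s) = (q1, s1)" by fastforce
  obtain q2 s2 where 2: "counter_step w (q1, s1) = (q2, s2)" by fastforce
  have "q1 \<in> Q" using Suc 1 by simp
  with 2 have "q2 \<in> Q" using succ_closed by (auto split: if_splits)
  moreover have "reaches phase_step (Go q, 0, tape w s) (Go q2, 0, tape w s2)"
    using reaches_trans[OF _ simulate_step[OF \<open>q1 \<in> Q\<close> 2]] Suc 1 by simp
  ultimately show ?case
    using 1 2 by simp
qed

lemma represents_initial: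
  "represents (initial tm w)
     (Start, 0, \<lambda>i. (False, if 0 \<le> i then letter_at w (nat i) else None, {}))"
  unfolding initial_def using special_phases
  by (auto simp: tm_def fun_eq_iff letter_at_def syms_def)

lemma tm_halts:
  assumes "reaches (counter_step w) (q0, \<lambda>_. 0) (q, s)" and "q = acc \<or> q = rej"
  shows "\<exists>j. fst ((step tm ^^ j) (initial tm w)) = enc_phase (Go q)"
proof -
  let ?y = "(Start, 0, \<lambda>i. (False, if 0 \<le> i then letter_at w (nat i) else None, {}))"
  have 1: "phase_step ?y = (Go q0, 0, tape w (\<lambda>_. 0))"
    by (auto simp: tape_def fun_eq_iff)
  have "reaches phase_step (Go q0, 0, tape w (\<lambda>_. 0)) (Go q, 0, tape w s)"
  proof -
    obtain j where "(counter_step w ^^ j) (q0, \<lambda>_. 0) = (q, s)"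
      using assms(1) unfolding reaches_def by blast
    with simulate[OF special(1), of j w "\<lambda>_. 0"] show ?thesis by simp
  qed
  with 1 have "reaches phase_step ?y (Go q, 0, tape w s)"
    by (rule reaches_step_eq)
  then obtain j where "(phase_step ^^ j) ?y = (Go q, 0, tape w s)"
    unfolding reaches_def by blast
  then have "represents ((step tm ^^ j) (initial tm w)) (Go q, 0, tape w s)"
    using represents_funpow[OF represents_initial[of w], of j] by simp
  then show ?thesis
    by (cases "(step tm ^^ j) (initial tm w)") (auto intro: exI[of _ j])
qed

theorem turing_decidableI:
  assumes "\<And>w. \<exists>s. reaches (counter_step w) (q0, \<lambda>_. 0) (if w \<in> L then acc else rej, s)"
  shows "turing_decidable L"
proof -
  have "(w \<in> L \<longrightarrow> accepts tm w) \<and> (w \<notin> L \<longrightarrow> rejects tm w)" for w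
  proof -
    obtain s where "reaches (counter_step w) (q0, \<lambda>_. 0) (if w \<in> L then acc else rej, s)"
      using assms by blast
    from tm_halts[OF this] show ?thesis
      by (auto simp: accepts_def rejects_def tm_def split: if_splits)
  qed
  with wf_tm show ?thesis
    unfolding turing_decidable_def by blast
qed

end


section \<open>Structured counter programs\<close>

datatype 'a com =
    Op nat action
  | Seq "'a com" "'a com"
  | Cond nat "bool \<Rightarrow> 'a option \<Rightarrow> bool" "'a com" "'a com"
  | While nat "bool \<Rightarrow> 'a option \<Rightarrow> bool" "'a com"

text \<open>The commands still to be executed, or the verdict.\<close>

type_synonym 'a control = "'a com list + bool"

fun control_reg :: "'a control \<Rightarrow> nat" where
  "control_reg (Inl (Op r a # ks)) = r"
| "control_reg (Inl (Cond r b c d # ks)) = r"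
| "control_reg (Inl (While r b c # ks)) = r"
| "control_reg _ = 0"

fun control_act :: "'a control \<Rightarrow> action" where
  "control_act (Inl (Op r a # ks)) = a"
| "control_act _ = Nop"

fun control_succ :: "'a control \<Rightarrow> bool \<Rightarrow> 'a option \<Rightarrow> 'a control" where
  "control_succ (Inl (Op r a # ks)) z x = Inl ks"
| "control_succ (Inl (Seq c d # ks)) z x = Inl (c # d # ks)"
| "control_succ (Inl (Cond r b c d # ks)) z x = Inl ((if b z x then c else d) # ks)"
| "control_succ (Inl (While r b c # ks)) z x =
     (if b z x then Inl (c # While r b c # ks) else Inl ks)"
| "control_succ (Inl []) z x = Inr (\<not> z)"
| "control_succ (Inr v) z x = Inr v"

interpretation program: counter_control control_reg control_act control_succ "Inr True" "Inr False" .

abbreviation exec :: "'a::finite list \<Rightarrow> 'a control \<times> (nat \<Rightarrow> nat) \<Rightarrow> 'a control \<times> (nat \<Rightarrow> nat)" where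
  "exec \<equiv> program.counter_step"

text \<open>Lists of commands are infinitely many, a machine has finitely many states. These are the
  lists that can arise while \<open>c\<close> runs in front of \<open>ks\<close>; they remain finite
  in number because the body of a loop is followed by that same loop.\<close>

primrec controls :: "'a com \<Rightarrow> 'a com list \<Rightarrow> 'a com list set" where
  "controls (Op r a) ks = {Op r a # ks}"
| "controls (Seq c d) ks = insert (Seq c d # ks) (controls c (d # ks) \<union> controls d ks)"
| "controls (Cond r b c d) ks = insert (Cond r b c d # ks) (controls c ks \<union> controls d ks)"
| "controls (While r b c) ks = insert (While r b c # ks) (controls c (While r b c # ks))"

lemma finite_controls: "finite (controls c ks)"
  by (induction c arbitrary: ks) auto

lemma start_in_controls: "c # ks \<in> controls c ks"
  by (cases c) auto

lemma controls_closed: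
  assumes "l \<in> controls c ks"
  shows "control_succ (Inl l) z x \<in> Inl ` insert ks (controls c ks)"
  using assms
proof (induction c arbitrary: ks)
  case (Seq c d)
  from Seq.prems consider "l = Seq c d # ks" | "l \<in> controls c (d # ks)" | "l \<in> controls d ks"
    by auto
  then show ?case
  proof cases
    case 2
    then show ?thesis using Seq.IH(1)[OF 2] start_in_controls[of d ks] by auto
  next
    case 3
    then show ?thesis using Seq.IH(2)[OF 3] by auto
  qed (use start_in_controls[of c "d # ks"] in auto)
next
  case (Cond r b c d)
  from Cond.prems consider "l = Cond r b c d # ks" | "l \<in> controls c ks" | "l \<in> controls d ks"
    by auto
  then show ?case
  proof cases
    case 2
    then show ?thesis using Cond.IH(1)[OF 2] by auto
  next
    case 3
    then show ?thesis using Cond.IH(2)[OF 3] by auto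
  qed (use start_in_controls in auto)
next
  case (While r b c)
  from While.prems consider "l = While r b c # ks" | "l \<in> controls c (While r b c # ks)"
    by auto
  then show ?case
  proof cases
    case 2
    then show ?thesis using While.IH[OF 2] by auto
  qed (use start_in_controls in auto)
qed auto

text \<open>\<open>Seq\<close> counts as a use of counter 0, since \<open>control_reg\<close>
  defaults to 0 there.\<close>

primrec reg_bound :: "'a com \<Rightarrow> nat" where
  "reg_bound (Op r a) = Suc r"
| "reg_bound (Seq c d) = max 1 (max (reg_bound c) (reg_bound d))"
| "reg_bound (Cond r b c d) = max (Suc r) (max (reg_bound c) (reg_bound d))"
| "reg_bound (While r b c) = max (Suc r) (reg_bound c)"

lemma control_reg_less: "l \<in> controls c ks \<Longrightarrow> control_reg (Inl l) < reg_bound c"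
  by (induction c arbitrary: ks) (auto simp: less_max_iff_disj)

text \<open>Quantifying over the remaining commands \<open>ks\<close> makes runs composable:
  whatever follows can be supplied later.\<close>

definition runs :: "'a::finite list \<Rightarrow> 'a com \<Rightarrow> (nat \<Rightarrow> nat) \<Rightarrow> (nat \<Rightarrow> nat) \<Rightarrow> bool" where
  "runs w c s s' \<longleftrightarrow> (\<forall>ks. reaches (exec w) (Inl (c # ks), s) (Inl ks, s'))"

lemma turing_decidable_by_program:
  assumes "\<And>w. \<exists>s. runs w c (\<lambda>_. 0) s \<and> (s 0 \<noteq> 0 \<longleftrightarrow> w \<in> L)"
  shows "turing_decidable (L :: 'a::finite list set)"
proof -
  interpret counter_machine control_reg control_act "control_succ :: 'a control \<Rightarrow> _"
    "Inr True" "Inr False" "Inl ` insert [] (controls c []) \<union> range Inr" "max 1 (reg_bound c)" "Inl [c]"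
  proof
    show "finite (Inl ` insert [] (controls c []) \<union> range Inr :: 'a control set)"
      using finite_controls by auto
    fix q :: "'a control" assume "q \<in> Inl ` insert [] (controls c []) \<union> range Inr"
    then consider v where "q = Inr v" | "q = Inl []" | l where "q = Inl l" "l \<in> controls c []"
      by auto
    note q_cases = this
    show "control_reg q < max 1 (reg_bound c)"
      by (cases rule: q_cases) (use control_reg_less in \<open>auto simp: less_max_iff_disj\<close>)
    fix z x
    show "control_succ q z x \<in> Inl ` insert [] (controls c []) \<union> range Inr"
    proof (cases rule: q_cases)
      case (3 l)
      then show ?thesis using controls_closed[OF 3(2), of z x] by auto
    qed auto
  qed (use start_in_controls[of c "[]"] in auto)
  show ?thesis
  proof (rule turing_decidableI)
    fix w
    obtain s where s: "runs w c (\<lambda>_. 0) s" "s 0 \<noteq> 0 \<longleftrightarrow> w \<in> L"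
      using assms by blast
    \<comment> \<open>The empty list inspects counter 0, the default of \<open>control_reg\<close>,
      and turns its zero test into the verdict; the default action \<open>Nop\<close> leaves the
      counters alone.\<close>
    have "exec w (Inl [], s) = (if w \<in> L then Inr True else Inr False, s)"
      using s(2) by auto
    then have "reaches (exec w) (Inl [], s) (if w \<in> L then Inr True else Inr False, s)"
      by (rule reaches_step_eq[OF _ reaches_refl])
    with s(1) have "reaches (exec w) (Inl [c], \<lambda>_. 0) (if w \<in> L then Inr True else Inr False, s)"
      unfolding runs_def by (blast intro: reaches_trans)
    then show "\<exists>s. reaches (exec w) (Inl [c], \<lambda>_. 0) (if w \<in> L then Inr True else Inr False, s)"
      by blast
  qed
qed

section \<open>Rules for running programs, and moving of counters\<close>

lemma runs_Op: "runs w (Op r a) s (act_on a r s)"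
  unfolding runs_def by (auto intro!: reaches_step_eq[OF _ reaches_refl])

lemma runs_Seq: "runs w c s s' \<Longrightarrow> runs w d s' s'' \<Longrightarrow> runs w (Seq c d) s s''"
  unfolding runs_def
  by (intro allI) (rule reaches_step_eq, auto intro: reaches_trans)

lemma runs_Cond:
  "runs w (if b (s r = 0) (letter_at w (s r)) then c else d) s s' \<Longrightarrow> runs w (Cond r b c d) s s'"
  unfolding runs_def
  by (intro allI) (rule reaches_step_eq, auto)

lemma runs_While_end: "\<not> b (s r = 0) (letter_at w (s r)) \<Longrightarrow> runs w (While r b c) s s"
  unfolding runs_def by (auto intro!: reaches_step_eq[OF _ reaches_refl])

lemma runs_While_step:
  assumes "b (s r = 0) (letter_at w (s r))" "runs w c s s'" "runs w (While r b c) s' s''"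
  shows "runs w (While r b c) s s''"
  unfolding runs_def
proof
  fix ks
  have "exec w (Inl (While r b c # ks), s) = (Inl (c # While r b c # ks), s)"
    using assms(1) by simp
  then show "reaches (exec w) (Inl (While r b c # ks), s) (Inl ks, s'')"
    using assms(2,3) unfolding runs_def by (blast intro: reaches_trans reaches_step_eq)
qed

abbreviation nonzero :: "bool \<Rightarrow> 'a option \<Rightarrow> bool" where
  "nonzero \<equiv> \<lambda>z x. \<not> z"

definition Clear :: "nat \<Rightarrow> 'a com" where
  "Clear r = While r nonzero (Op r Dec)"

lemma runs_Clear: "runs w (Clear r) s (s(r := 0))"
proof (induction "s r" arbitrary: s)
  case 0
  then have "s(r := 0) = s" by auto
  moreover have "runs w (Clear r) s s"
    unfolding Clear_def using 0 by (intro runs_While_end) simp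
  ultimately show ?case by (simp only:)
next
  case (Suc n)
  have "n = act_on Dec r s r" using Suc(2) by (simp add: diff_Suc split: nat.split)
  from Suc(1)[of "act_on Dec r s", OF this] have "runs w (Clear r) (act_on Dec r s) (s(r := 0))" by simp
  with Suc(2) show ?case
    unfolding Clear_def by - (rule runs_While_step[OF _ runs_Op], auto)
qed

definition Move :: "nat \<Rightarrow> nat \<Rightarrow> 'a com" where
  "Move r q = While r nonzero (Seq (Op r Dec) (Op q Inc))"

lemma runs_Move: "r \<noteq> q \<Longrightarrow> runs w (Move r q) s (s(r := 0, q := s q + s r))"
proof (induction "s r" arbitrary: s)
  case 0
  then have "s(r := 0, q := s q + s r) = s" by auto
  moreover have "runs w (Move r q) s s"
    unfolding Move_def using 0 by (intro runs_While_end) simp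
  ultimately show ?case by (simp only:)
next
  case (Suc n)
  let ?s = "act_on Inc q (act_on Dec r s)"
  have "runs w (Move r q) ?s (?s(r := 0, q := ?s q + ?s r))"
    using Suc(2,3) by (intro Suc(1)) (auto simp: diff_Suc split: nat.split)
  also have "?s(r := 0, q := ?s q + ?s r) = s(r := 0, q := s q + s r)"
    using Suc(2,3) by (auto simp: fun_eq_iff)
  finally have "runs w (Move r q) ?s (s(r := 0, q := s q + s r))" .
  moreover have "runs w (Seq (Op r Dec) (Op q Inc)) s ?s"
    by (intro runs_Seq[OF runs_Op runs_Op])
  ultimately show ?case
    unfolding Move_def using Suc(2) by - (rule runs_While_step, auto)
qed

text \<open>A loop over a counter destroys it. Copying therefore fills two targets, one of which is
  moved back afterwards.\<close>

definition Move2 :: "nat \<Rightarrow> nat \<Rightarrow> nat \<Rightarrow> 'a com" where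
  "Move2 r q p = While r nonzero (Seq (Op r Dec) (Seq (Op q Inc) (Op p Inc)))"

lemma runs_Move2:
  "distinct [r, q, p] \<Longrightarrow> runs w (Move2 r q p) s (s(r := 0, q := s q + s r, p := s p + s r))"
proof (induction "s r" arbitrary: s)
  case 0
  then have "s(r := 0, q := s q + s r, p := s p + s r) = s" by (auto simp: fun_eq_iff)
  moreover have "runs w (Move2 r q p) s s"
    unfolding Move2_def using 0 by (intro runs_While_end) simp
  ultimately show ?case by (simp only:)
next
  case (Suc n)
  let ?s = "act_on Inc p (act_on Inc q (act_on Dec r s))"
  have "runs w (Move2 r q p) ?s (?s(r := 0, q := ?s q + ?s r, p := ?s p + ?s r))"
    using Suc(2,3) by (intro Suc(1)) (auto simp: diff_Suc split: nat.split)
  also have "?s(r := 0, q := ?s q + ?s r, p := ?s p + ?s r) = s(r := 0, q := s q + s r, p := s p + s r)"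
    using Suc(2,3) by (auto simp: fun_eq_iff)
  finally have "runs w (Move2 r q p) ?s (s(r := 0, q := s q + s r, p := s p + s r))" .
  moreover have "runs w (Seq (Op r Dec) (Seq (Op q Inc) (Op p Inc))) s ?s"
    by (intro runs_Seq[OF runs_Op] runs_Op)
  ultimately show ?case
    unfolding Move2_def using Suc(2) by - (rule runs_While_step, auto)
qed

text \<open>
  The result may be requested in any counter \<open>u \<ge> t\<close>, so that subprograms can be placed above
  the counters already in use; those beyond \<open>u\<close> are scratch.
\<close>

definition computable :: "nat \<Rightarrow> ('a::finite list \<times> (nat \<Rightarrow> nat) \<Rightarrow> nat) \<Rightarrow> bool" where
  "computable t f \<longleftrightarrow>
     (\<forall>w s s'. (\<forall>r<t. s r = s' r) \<longrightarrow> f (w, s) = f (w, s')) \<and>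
     (\<forall>u\<ge>t. \<exists>c. \<forall>w s. \<exists>s'. runs w c s s' \<and> (\<forall>r<u. s' r = s r) \<and> s' u = f (w, s))"

text \<open>A subprogram placed at \<open>u\<close> may overwrite everything from \<open>u\<close>
  on. Locality guarantees that functions evaluated after it still have the value they had at the
  outset.\<close>

lemma computable_dep: "computable t f \<Longrightarrow> (\<And>r. r < t \<Longrightarrow> s r = s' r) \<Longrightarrow> f (w, s) = f (w, s')"
  unfolding computable_def by blast

lemma computable_program:
  assumes "computable t f" "t \<le> u"
  obtains c where "\<And>w s. \<exists>s'. runs w c s s' \<and> (\<forall>r<u. s' r = s r) \<and> s' u = f (w, s)"
  using assms unfolding computable_def by blast

text \<open>The body of a recursion lives above the counters that hold its bound variables;
  parameters from outside are lifted to that level.\<close>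

lemma computable_mono: "computable t f \<Longrightarrow> t \<le> u \<Longrightarrow> computable u f"
  unfolding computable_def by (meson order.strict_trans2 order_trans)

lemma computable_counter:
  assumes "r < t"
  shows "computable t (\<lambda>e :: 'a::finite list \<times> _. snd e r)"
  unfolding computable_def
proof (intro conjI allI impI)
  fix u assume u: "t \<le> u"
  let ?c = "Seq (Clear u) (Seq (Clear (Suc u)) (Seq (Move2 r u (Suc u)) (Move (Suc u) r)))"
  have "runs w ?c s (s(u := s r, Suc u := 0))" for w :: "'a list" and s
  proof -
    let ?s = "(s(u := 0))(Suc u := 0)"
    let ?s2 = "?s(r := 0, u := ?s u + ?s r, Suc u := ?s (Suc u) + ?s r)"
    have "runs w ?c s (?s2(Suc u := 0, r := ?s2 r + ?s2 (Suc u)))"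
      using assms u by (intro runs_Seq[OF runs_Clear] runs_Seq[OF runs_Move2] runs_Move) auto
    also have "?s2(Suc u := 0, r := ?s2 r + ?s2 (Suc u)) = s(u := s r, Suc u := 0)"
      using assms u by (auto simp: fun_eq_iff)
    finally show ?thesis .
  qed
  then show "\<exists>c. \<forall>w s. \<exists>s'. runs (w :: 'a list) c s s' \<and> (\<forall>r<u. s' r = s r) \<and> s' u = snd (w, s) r"
    by (intro exI[of _ ?c] allI exI conjI) (assumption, auto)
qed (use assms in auto)

lemma computable_0: "computable t (\<lambda>e :: 'a::finite list \<times> _. 0)"
  unfolding computable_def
proof (intro conjI allI impI)
  fix u assume "t \<le> u"
  show "\<exists>c. \<forall>w s. \<exists>s'. runs (w :: 'a list) c s s' \<and> (\<forall>r<u. s' r = s r) \<and> s' u = 0"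
    by (intro exI[of _ "Clear u"] allI exI conjI) (rule runs_Clear, auto)
qed simp

lemma computable_Suc:
  assumes "computable t f"
  shows "computable t (\<lambda>e. Suc (f e))"
  unfolding computable_def
proof (intro conjI allI impI)
  fix u assume "t \<le> u"
  then obtain c where c: "\<And>w s. \<exists>s'. runs w c s s' \<and> (\<forall>r<u. s' r = s r) \<and> s' u = f (w, s)"
    using assms computable_program by blast
  have "\<exists>s'. runs w (Seq c (Op u Inc)) s s' \<and> (\<forall>r<u. s' r = s r) \<and> s' u = Suc (f (w, s))" for w s
  proof -
    obtain s' where s': "runs w c s s'" "\<forall>r<u. s' r = s r" "s' u = f (w, s)"
      using c by blast
    from runs_Seq[OF s'(1) runs_Op[of w u Inc]] s'(2,3) show ?thesis
      by (intro exI[of _ "act_on Inc u s'"]) auto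
  qed
  then show "\<exists>c. \<forall>w s. \<exists>s'. runs w c s s' \<and> (\<forall>r<u. s' r = s r) \<and> s' u = Suc (f (w, s))"
    by blast
next
  fix w and s s' :: "nat \<Rightarrow> nat" assume "\<forall>r<t. s r = s' r"
  then have "f (w, s) = f (w, s')" by (intro computable_dep[OF assms]) simp
  then show "Suc (f (w, s)) = Suc (f (w, s'))" by simp
qed

text \<open>
  Bound variables are treated by higher-order abstract syntax: the premise on the body \<open>g\<close>
  substitutes arbitrary computable functions for its arguments.
\<close>

lemma computable_rec:
  fixes g :: "'a::finite list \<times> (nat \<Rightarrow> nat) \<Rightarrow> nat \<Rightarrow> nat \<Rightarrow> nat"
  assumes n: "computable t n" and a: "computable t a"
    and g: "\<And>u i x. t \<le> u \<Longrightarrow> computable u i \<Longrightarrow> computable u x \<Longrightarrow> computable u (\<lambda>e. g e (i e) (x e))"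
  shows "computable t (\<lambda>e. rec_nat (a e) (g e) (n e))"
  unfolding computable_def
proof (intro conjI allI impI)
  \<comment> \<open>Substituting constant functions for the arguments in the premise on
    \<open>g\<close> yields that \<open>g\<close> itself looks only at the counters below
    \<open>t\<close>.\<close>
  have const: "computable t (\<lambda>e. k)" for k
    by (induction k) (auto intro: computable_0 computable_Suc)
  have g_dep: "g (w, s) = g (w, s')" if "\<And>r. r < t \<Longrightarrow> s r = s' r" for w s s'
  proof (intro ext)
    show "g (w, s) i x = g (w, s') i x" for i x
      using computable_dep[OF g[OF order_refl const[of i] const[of x]], of s s' w] that by blast
  qed
  fix w and s s' :: "nat \<Rightarrow> nat" assume "\<forall>r<t. s r = s' r"
  then show "rec_nat (a (w, s)) (g (w, s)) (n (w, s)) = rec_nat (a (w, s')) (g (w, s')) (n (w, s'))"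
    using g_dep[of s s'] computable_dep[OF n, of s s'] computable_dep[OF a, of s s'] by simp
next
  have const: "computable t (\<lambda>e. k)" for k
    by (induction k) (auto intro: computable_0 computable_Suc)
  have g_dep: "g (w, s) = g (w, s')" if "\<And>r. r < t \<Longrightarrow> s r = s' r" for w s s'
  proof (intro ext)
    show "g (w, s) i x = g (w, s') i x" for i x
      using computable_dep[OF g[OF order_refl const[of i] const[of x]], of s s' w] that by blast
  qed
  fix u assume u: "t \<le> u"
  \<comment> \<open>Layout: \<open>u\<close> counts the rounds still to go and finally takes the
    result, \<open>u + 1\<close> is the index, \<open>u + 2\<close> the accumulator, and
    \<open>u + 3\<close> receives the new value from the body.\<close>
  have g': "computable (u + 3) (\<lambda>e. g e (snd e (u + 1)) (snd e (u + 2)))"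
    using u by (intro g computable_counter) auto
  obtain cn where cn: "\<And>w s. \<exists>s'. runs w cn s s' \<and> (\<forall>r<u. s' r = s r) \<and> s' u = n (w, s)"
    using computable_program[OF n] u by blast
  obtain ca where ca: "\<And>w s. \<exists>s'. runs w ca s s' \<and> (\<forall>r<u+2. s' r = s r) \<and> s' (u+2) = a (w, s)"
    using computable_program[OF a, of "u + 2"] u by auto
  obtain cg where cg: "\<And>w s. \<exists>s'. runs w cg s s' \<and> (\<forall>r<u+3. s' r = s r) \<and>
      s' (u+3) = g (w, s) (s (u + 1)) (s (u + 2))"
    using computable_program[OF g' order_refl] by auto
  let ?body = "Seq (Op u Dec) (Seq cg (Seq (Clear (u+2)) (Seq (Move (u+3) (u+2)) (Op (u+1) Inc))))"
  let ?loop = "While u nonzero ?body"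
  let ?c = "Seq cn (Seq (Clear (u+1)) (Seq ca (Seq ?loop (Move (u+2) u))))"
  have body: "\<exists>s'. runs w ?body s s' \<and> (\<forall>r<u. s' r = s r) \<and> s' u = s u - 1 \<and>
      s' (u+1) = Suc (s (u+1)) \<and> s' (u+2) = g (w, s) (s (u+1)) (s (u+2))" for w s
  proof -
    let ?s1 = "act_on Dec u s"
    obtain s2 where s2: "runs w cg ?s1 s2" "\<forall>r<u+3. s2 r = ?s1 r"
        "s2 (u+3) = g (w, ?s1) (?s1 (u + 1)) (?s1 (u + 2))"
      using cg by blast
    let ?s3 = "s2(u+2 := 0)"
    let ?s4 = "?s3(u+3 := 0, u+2 := ?s3 (u+2) + ?s3 (u+3))"
    let ?s5 = "act_on Inc (u+1) ?s4"
    have "runs w ?body s ?s5"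
      by (intro runs_Seq[OF runs_Op] runs_Seq[OF s2(1)] runs_Seq[OF runs_Clear] runs_Seq[OF runs_Move]
          runs_Op) auto
    moreover have "g (w, ?s1) = g (w, s)"
      using u by (intro g_dep) auto
    ultimately show ?thesis
      using s2(2,3) by (intro exI[of _ ?s5]) auto
  qed
  \<comment> \<open>Generalised to a state after \<open>i\<close> rounds with \<open>j\<close> still
    to go, so that the induction on \<open>j\<close> can pass on an increased
    \<open>i\<close>.\<close>
  have loop: "\<exists>s'. runs w ?loop s s' \<and> (\<forall>r<u. s' r = s r) \<and> s' u = 0 \<and>
      s' (u+2) = rec_nat (a (w, s)) (g (w, s)) (i + j)"
    if "s u = j" "s (u+1) = i" "s (u+2) = rec_nat (a (w, s)) (g (w, s)) i" for w s i j
    using that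
  proof (induction j arbitrary: i s)
    case 0
    then have "runs w ?loop s s" by (intro runs_While_end) auto
    with 0 show ?case by auto
  next
    case (Suc j)
    obtain s1 where s1: "runs w ?body s s1" "\<forall>r<u. s1 r = s r" "s1 u = s u - 1"
      "s1 (u+1) = Suc (s (u+1))" "s1 (u+2) = g (w, s) (s (u+1)) (s (u+2))"
      using body by blast
    have eqs: "a (w, s1) = a (w, s)" "g (w, s1) = g (w, s)"
      using u s1(2) by (auto intro!: g_dep computable_dep[OF a])
    have "\<exists>s'. runs w ?loop s1 s' \<and> (\<forall>r<u. s' r = s1 r) \<and> s' u = 0 \<and>
      s' (u+2) = rec_nat (a (w, s1)) (g (w, s1)) (Suc i + j)"
      using s1 Suc.prems by (intro Suc.IH) (auto simp: eqs)
    then obtain s2 where s2: "runs w ?loop s1 s2" "\<forall>r<u. s2 r = s1 r" "s2 u = 0"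
      "s2 (u+2) = rec_nat (a (w, s1)) (g (w, s1)) (Suc i + j)" by blast
    have "runs w ?loop s s2"
      using Suc.prems(1) by (intro runs_While_step[OF _ s1(1) s2(1)]) auto
    then show ?case
      using s2(2-4) s1(2) eqs by (intro exI[of _ s2]) auto
  qed
  have "\<exists>s'. runs w ?c s s' \<and> (\<forall>r<u. s' r = s r) \<and> s' u = rec_nat (a (w, s)) (g (w, s)) (n (w, s))" for w s
  proof -
    obtain s1 where s1: "runs w cn s s1" "\<forall>r<u. s1 r = s r" "s1 u = n (w, s)"
      using cn by blast
    let ?s2 = "s1(u+1 := 0)"
    obtain s3 where s3: "runs w ca ?s2 s3" "\<forall>r<u+2. s3 r = ?s2 r" "s3 (u+2) = a (w, ?s2)"
      using ca by blast
    have eqs: "a (w, ?s2) = a (w, s)" "a (w, s3) = a (w, s)" "g (w, s3) = g (w, s)"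
      using u s1(2) s3(2) by (auto intro!: g_dep computable_dep[OF a])
    have "\<exists>s'. runs w ?loop s3 s' \<and> (\<forall>r<u. s' r = s3 r) \<and> s' u = 0 \<and>
      s' (u+2) = rec_nat (a (w, s3)) (g (w, s3)) (0 + n (w, s))"
      using s3 s1 eqs by (intro loop) auto
    then obtain s4 where s4: "runs w ?loop s3 s4" "\<forall>r<u. s4 r = s3 r" "s4 u = 0"
      "s4 (u+2) = rec_nat (a (w, s3)) (g (w, s3)) (0 + n (w, s))" by blast
    let ?s5 = "s4(u+2 := 0, u := s4 u + s4 (u+2))"
    have "runs w ?c s ?s5"
      by (intro runs_Seq[OF s1(1)] runs_Seq[OF runs_Clear] runs_Seq[OF s3(1)] runs_Seq[OF s4(1)]
          runs_Move) auto
    then show ?thesis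
      using s1(2) s3(2) s4(2-4) eqs by (intro exI[of _ ?s5]) auto
  qed
  then show "\<exists>c. \<forall>w s. \<exists>s'. runs w c s s' \<and> (\<forall>r<u. s' r = s r) \<and>
      s' u = rec_nat (a (w, s)) (g (w, s)) (n (w, s))"
    by blast
qed

lemma computable_letter_test:
  assumes "computable t f"
  shows "computable t (\<lambda>e. of_bool (P (letter_at (fst e) (f e))))"
  unfolding computable_def
proof (intro conjI allI impI)
  fix u assume "t \<le> u"
  then obtain c where c: "\<And>w s. \<exists>s'. runs w c s s' \<and> (\<forall>r<u. s' r = s r) \<and> s' u = f (w, s)"
    using assms computable_program by blast
  let ?c = "Seq c (Cond u (\<lambda>_. P) (Seq (Clear u) (Op u Inc)) (Clear u))"
  have "\<exists>s'. runs w ?c s s' \<and> (\<forall>r<u. s' r = s r) \<and> s' u = of_bool (P (letter_at w (f (w, s))))" for w s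
  proof -
    obtain s' where s': "runs w c s s'" "\<forall>r<u. s' r = s r" "s' u = f (w, s)"
      using c by blast
    show ?thesis
    proof (cases "P (letter_at w (f (w, s)))")
      case True
      have "runs w (Seq (Clear u) (Op u Inc)) s' (act_on Inc u (s'(u := 0)))"
        by (intro runs_Seq[OF runs_Clear runs_Op])
      then have "runs w ?c s (act_on Inc u (s'(u := 0)))"
        using True s' by (intro runs_Seq[OF s'(1)] runs_Cond) auto
      then show ?thesis using s' True by (intro exI[of _ "act_on Inc u (s'(u := 0))"]) auto
    next
      case False
      have "runs w ?c s (s'(u := 0))"
        using False s' runs_Clear by (intro runs_Seq[OF s'(1)] runs_Cond) auto
      then show ?thesis using s' False by (intro exI[of _ "s'(u := 0)"]) auto
    qed
  qed
  then show "\<exists>c. \<forall>w s. \<exists>s'. runs w c s s' \<and> (\<forall>r<u. s' r = s r) \<and>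
      s' u = of_bool (P (letter_at (fst (w, s)) (f (w, s))))"
    unfolding fst_conv by blast
next
  fix w and s s' :: "nat \<Rightarrow> nat" assume "\<forall>r<t. s r = s' r"
  then have "f (w, s) = f (w, s')" by (intro computable_dep[OF assms]) simp
  then show "of_bool (P (letter_at (fst (w, s)) (f (w, s)))) = of_bool (P (letter_at (fst (w, s')) (f (w, s'))))" by simp
qed

text \<open>The length is stored nowhere; a pointer advances from 0 until no letter is in
  view.\<close>

lemma computable_length: "computable t (\<lambda>e :: 'a::finite list \<times> _. length (fst e))"
  unfolding computable_def
proof (intro conjI allI impI)
  fix u assume "t \<le> u"
  let ?loop = "While u (\<lambda>z x. x \<noteq> None) (Op u Inc)"
  have loop: "runs w ?loop s (s(u := length w))" if "j = length w - s u" "s u \<le> length w" for w :: "'a list" and s j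
    using that
  proof (induction j arbitrary: s)
    case 0
    then have "s(u := length w) = s" by auto
    moreover have "runs w ?loop s s"
      using 0 by (intro runs_While_end) (auto simp: letter_at_def)
    ultimately show ?case by simp
  next
    case (Suc j)
    have "runs w ?loop (act_on Inc u s) ((act_on Inc u s)(u := length w))"
      using Suc.prems by (intro Suc.IH) auto
    then have *: "runs w ?loop (act_on Inc u s) (s(u := length w))" by simp
    have "letter_at w (s u) \<noteq> None"
      using Suc.prems by (simp add: letter_at_def)
    then show ?case
      by (rule runs_While_step[OF _ runs_Op *])
  qed
  have "runs w (Seq (Clear u) ?loop) s (s(u := length w))" for w :: "'a list" and s
    using runs_Seq[OF runs_Clear loop[OF refl, of "s(u := 0)" w]] by simp
  then show "\<exists>c. \<forall>w s. \<exists>s'. runs (w :: 'a list) c s s' \<and> (\<forall>r<u. s' r = s r) \<and> s' u = length (fst (w, s))"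
    by (intro exI[of _ "Seq (Clear u) ?loop"] allI exI conjI) (assumption, auto)
qed auto

theorem turing_decidable_computable:
  assumes "computable 0 (\<lambda>e. f (fst e))"
  shows "turing_decidable {w. f w \<noteq> 0}"
proof -
  obtain c where c: "\<And>w s. \<exists>s'. runs w c s s' \<and> (\<forall>r<0. s' r = s r) \<and> s' 0 = f (fst (w, s))"
    using computable_program[OF assms order_refl] by blast
  show ?thesis
  proof (rule turing_decidable_by_program[of c])
    fix w
    obtain s where "runs w c (\<lambda>_. 0) s" "s 0 = f w"
      using c by fastforce
    then show "\<exists>s. runs w c (\<lambda>_. 0) s \<and> (s 0 \<noteq> 0 \<longleftrightarrow> w \<in> {w. f w \<noteq> 0})"
      by (intro exI[of _ s]) simp
  qed
qed


section \<open>Primitive recursive functions of the input\<close>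

named_theorems computable_intros

declare computable_0 [computable_intros] computable_Suc [computable_intros]
  computable_rec [computable_intros] computable_length [computable_intros]

lemma computable_const [computable_intros]: "computable t (\<lambda>e. k)"
  by (induction k) (auto intro: computable_0 computable_Suc)

lemma computable_letter [computable_intros]:
  "computable t f \<Longrightarrow> computable t (\<lambda>e. of_bool (letter_at (fst e) (f e) = Some a))"
  by (rule computable_letter_test)

lemma computable_pred:
  assumes "computable t f"
  shows "computable t (\<lambda>e. f e - 1)"
proof -
  have "computable t (\<lambda>e. rec_nat 0 (\<lambda>i x. i) (f e))"
    using assms by - (intro computable_intros; assumption)
  moreover have "rec_nat 0 (\<lambda>i x. i) n = n - 1" for n
    by (cases n) auto
  ultimately show ?thesis by simp
qed

lemma computable_plus [computable_intros]:
  assumes "computable t f" "computable t g"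
  shows "computable t (\<lambda>e. f e + g e)"
proof -
  have "computable t (\<lambda>e. rec_nat (f e) (\<lambda>i x. Suc x) (g e))"
    using assms by - (intro computable_intros; assumption)
  moreover have "rec_nat a (\<lambda>i x. Suc x) n = a + n" for a n
    by (induction n) auto
  ultimately show ?thesis by simp
qed

lemma computable_minus [computable_intros]:
  assumes "computable t f" "computable t g"
  shows "computable t (\<lambda>e. f e - g e)"
proof -
  have "computable t (\<lambda>e. rec_nat (f e) (\<lambda>i x. x - 1) (g e))"
    using assms by - (intro computable_intros computable_pred; assumption)
  moreover have "rec_nat a (\<lambda>i x. x - 1) n = a - n" for a n
    by (induction n) auto
  ultimately show ?thesis by simp
qed

lemma computable_times [computable_intros]:
  assumes "computable t f" "computable t g"
  shows "computable t (\<lambda>e. f e * g e)"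
proof -
  have "computable t (\<lambda>e. rec_nat 0 (\<lambda>i x. x + f e) (g e))"
    using assms by - (intro computable_intros; (assumption | (erule computable_mono, assumption)))
  moreover have "rec_nat 0 (\<lambda>i x. x + a) n = a * n" for a n :: nat
    by (induction n) auto
  ultimately show ?thesis by simp
qed

lemma computable_power [computable_intros]:
  assumes "computable t f" "computable t g"
  shows "computable t (\<lambda>e. f e ^ g e)"
proof -
  have "computable t (\<lambda>e. rec_nat 1 (\<lambda>i x. x * f e) (g e))"
    using assms by - (intro computable_intros; (assumption | (erule computable_mono, assumption)))
  moreover have "rec_nat 1 (\<lambda>i x. x * a) n = a ^ n" for a n :: nat
    by (induction n) auto
  ultimately show ?thesis by simp
qed

lemma computable_fact [computable_intros]:
  assumes "computable t f"
  shows "computable t (\<lambda>e. fact (f e))"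
proof -
  have "computable t (\<lambda>e. rec_nat 1 (\<lambda>i x. Suc i * x) (f e))"
    using assms by - (intro computable_intros; assumption)
  moreover have "rec_nat 1 (\<lambda>i x. Suc i * x) n = fact n" for n
    by (induction n) auto
  ultimately show ?thesis by simp
qed

lemma computable_not [computable_intros]:
  assumes "computable t (\<lambda>e. of_bool (P e))"
  shows "computable t (\<lambda>e. of_bool (\<not> P e))"
proof -
  have "computable t (\<lambda>e. 1 - of_bool (P e))"
    using assms by - (intro computable_intros; assumption)
  moreover have "1 - of_bool p = (of_bool (\<not> p) :: nat)" for p
    by simp
  ultimately show ?thesis by simp
qed

lemma computable_conj [computable_intros]:
  assumes "computable t (\<lambda>e. of_bool (P e))" "computable t (\<lambda>e. of_bool (Q e))"
  shows "computable t (\<lambda>e. of_bool (P e \<and> Q e))"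
proof -
  have "computable t (\<lambda>e. of_bool (P e) * of_bool (Q e))"
    using assms by - (intro computable_intros; assumption)
  then show ?thesis by (simp only: of_bool_conj)
qed

lemma computable_imp [computable_intros]:
  assumes "computable t (\<lambda>e. of_bool (P e))" "computable t (\<lambda>e. of_bool (Q e))"
  shows "computable t (\<lambda>e. of_bool (P e \<longrightarrow> Q e))"
proof -
  have "computable t (\<lambda>e. of_bool (\<not> (P e \<and> \<not> Q e)))"
    using assms by - (intro computable_intros; assumption)
  then show ?thesis by (simp only: not_not de_Morgan_conj imp_conv_disj)
qed

lemma computable_le [computable_intros]:
  assumes "computable t f" "computable t g"
  shows "computable t (\<lambda>e. of_bool (f e \<le> g e))"
proof -
  have "computable t (\<lambda>e. 1 - (f e - g e))"
    using assms by - (intro computable_intros; assumption)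
  moreover have "1 - (a - b) = (of_bool (a \<le> b) :: nat)" for a b :: nat
    by auto
  ultimately show ?thesis by simp
qed

lemma computable_less [computable_intros]:
  assumes "computable t f" "computable t g"
  shows "computable t (\<lambda>e. of_bool (f e < g e))"
  using computable_le[OF computable_Suc[OF assms(1)] assms(2)] by (simp add: Suc_le_eq)

lemma computable_eq [computable_intros]:
  assumes "computable t f" "computable t g"
  shows "computable t (\<lambda>e. of_bool (f e = g e))"
proof -
  have "computable t (\<lambda>e. of_bool (f e \<le> g e \<and> g e \<le> f e))"
    using assms by - (intro computable_intros; assumption)
  then show ?thesis by (simp only: order_eq_iff)
qed

text \<open>A case distinction is a recursion of length 0 or 1.\<close>

lemma computable_if [computable_intros]:
  assumes "computable t (\<lambda>e. of_bool (P e))" "computable t f" "computable t g"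
  shows "computable t (\<lambda>e. if P e then f e else g e)"
proof -
  have "computable t (\<lambda>e. rec_nat (g e) (\<lambda>i x. f e) (of_bool (P e)))"
    using assms by - (intro computable_intros; (assumption | (erule computable_mono, assumption)))
  moreover have "rec_nat b (\<lambda>i x. a) (of_bool p) = (if p then a else b)" for a b :: nat and p
    by simp
  ultimately show ?thesis by simp
qed

lemma computable_ball [computable_intros]:
  assumes "computable t n"
    and "\<And>u i. t \<le> u \<Longrightarrow> computable u i \<Longrightarrow> computable u (\<lambda>e. of_bool (P e (i e)))"
  shows "computable t (\<lambda>e. of_bool (\<forall>i<n e. P e i))"
proof -
  have "computable t (\<lambda>e. rec_nat 1 (\<lambda>i x. x * of_bool (P e i)) (n e))"
    using assms by - (intro computable_intros; assumption)
  moreover have "rec_nat 1 (\<lambda>i x. x * of_bool (R i)) m = (of_bool (\<forall>i<m. R i) :: nat)" for R m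
    by (induction m) (auto simp: less_Suc_eq)
  ultimately show ?thesis by simp
qed

text \<open>A counter that is reset on reaching the modulus. For modulus 0 the reset never happens,
  in accordance with \<open>a mod 0 = a\<close>.\<close>

lemma computable_mod [computable_intros]:
  assumes "computable t f" "computable t g"
  shows "computable t (\<lambda>e. f e mod g e)"
proof -
  have "computable t (\<lambda>e. rec_nat 0 (\<lambda>i x. if Suc x = g e then 0 else Suc x) (f e))"
    using assms by - (intro computable_intros; (assumption | (erule computable_mono, assumption)))
  moreover have "rec_nat 0 (\<lambda>i x. if Suc x = b then 0 else Suc x) a = a mod b" for a b
    by (induction a) (auto simp: mod_Suc)
  ultimately show ?thesis by simp
qed

text \<open>Counts the positive multiples of the divisor up to the dividend; for divisor 0 there are
  none, in accordance with \<open>a div 0 = 0\<close>.\<close>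

lemma computable_div [computable_intros]:
  assumes "computable t f" "computable t g"
  shows "computable t (\<lambda>e. f e div g e)"
proof -
  have "computable t (\<lambda>e. rec_nat 0 (\<lambda>i x. if Suc i mod g e = 0 then Suc x else x) (f e))"
    using assms by - (intro computable_intros; (assumption | (erule computable_mono, assumption)))
  moreover have "rec_nat 0 (\<lambda>i x. if Suc i mod b = 0 then Suc x else x) a = a div b" for a b
    by (induction a) (auto simp: div_Suc)
  ultimately show ?thesis by simp
qed

lemma computable_min [computable_intros]:
  assumes "computable t f" "computable t g"
  shows "computable t (\<lambda>e. min (f e) (g e))"
  unfolding min_def using assms by - (intro computable_intros; assumption)


section \<open>Solutions with bounded denominators\<close>

type_synonym lin_constraint = "bool \<times> int \<times> (nat \<Rightarrow> int)"

definition affine :: "nat \<Rightarrow> int \<Rightarrow> (nat \<Rightarrow> int) \<Rightarrow> (nat \<Rightarrow> real) \<Rightarrow> real" where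
  "affine m c a z = of_int c + (\<Sum>i<m. of_int (a i) * z i)"

definition above :: "bool \<Rightarrow> real \<Rightarrow> real \<Rightarrow> bool" where
  "above st u v \<longleftrightarrow> (if st then u < v else u \<le> v)"

fun satisfies :: "nat \<Rightarrow> (nat \<Rightarrow> real) \<Rightarrow> lin_constraint \<Rightarrow> bool" where
  "satisfies m z (st, c, a) \<longleftrightarrow> above st 0 (affine m c a z)"

text \<open>\<open>K\<close> bounds the coefficients of the unknowns; the constant terms are
  integers and enter no denominator. Eliminating an unknown adds two rows with multipliers up to
  \<open>K\<close>, hence \<open>2 * K * K\<close>. In back substitution \<open>fact K\<close>
  clears the division by a coefficient, and the 2 pays for a midpoint.\<close>

primrec denominator :: "nat \<Rightarrow> nat \<Rightarrow> nat" where
  "denominator 0 K = 1"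
| "denominator (Suc m) K = 2 * fact K * denominator m (2 * K * K)"

lemma denominator_pos: "0 < denominator m K"
  by (induction m arbitrary: K) auto

lemma affine_Suc: "affine (Suc m) c a z = affine m c a z + of_int (a m) * z m"
  by (simp add: affine_def)

lemma affine_cong: "(\<And>i. i < m \<Longrightarrow> z i = z' i) \<Longrightarrow> affine m c a z = affine m c a z'"
  unfolding affine_def by auto

lemma affine_combine:
  "affine m (\<beta> * c + \<gamma> * d) (\<lambda>i. \<beta> * a i + \<gamma> * b i) z =
     of_int \<beta> * affine m c a z + of_int \<gamma> * affine m d b z"
  by (simp add: affine_def sum_distrib_left sum.distrib algebra_simps)

lemma affine_Ints:
  assumes "\<And>i. i < m \<Longrightarrow> of_nat D * z i \<in> \<int>"
  shows "of_nat D * affine m c a z \<in> \<int>"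
proof -
  have "of_nat D * affine m c a z = of_nat D * of_int c + (\<Sum>i<m. of_int (a i) * (of_nat D * z i))"
    by (simp add: affine_def sum_distrib_left algebra_simps)
  also have "\<dots> \<in> \<int>"
    by (intro Ints_add Ints_sum Ints_mult[OF Ints_of_int] Ints_mult[OF Ints_of_nat Ints_of_int] assms) auto
  finally show ?thesis .
qed

text \<open>
  Between finitely many lower and upper bounds the point is chosen as the midpoint of the best
  ones, so only one factor 2 enters the denominator.
\<close>

lemma intermediate_point:
  fixes lo :: "'l \<Rightarrow> real" and up :: "'u \<Rightarrow> real"
  assumes fin: "finite A" "finite B"
    and le: "\<And>l u. l \<in> A \<Longrightarrow> u \<in> B \<Longrightarrow> above (sl l \<or> su u) (lo l) (up u)"
    and E: "\<And>l. l \<in> A \<Longrightarrow> of_nat E * lo l \<in> \<int>" "\<And>u. u \<in> B \<Longrightarrow> of_nat E * up u \<in> \<int>"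
  shows "\<exists>v. (\<forall>l\<in>A. above (sl l) (lo l) v) \<and> (\<forall>u\<in>B. above (su u) v (up u)) \<and>
    of_nat (2 * E) * v \<in> \<int>"
proof -
  have max: "\<exists>l\<in>A. \<forall>l'\<in>A. lo l' \<le> lo l" if "A \<noteq> {}"
  proof -
    have "Max (lo ` A) \<in> lo ` A" using that fin by (intro Max_in) auto
    then obtain l where "l \<in> A" "lo l = Max (lo ` A)" by auto
    then show ?thesis using fin by (intro bexI[of _ l]) auto
  qed
  have min: "\<exists>u\<in>B. \<forall>u'\<in>B. up u \<le> up u'" if "B \<noteq> {}"
  proof -
    have "Min (up ` B) \<in> up ` B" using that fin by (intro Min_in) auto
    then obtain u where "u \<in> B" "up u = Min (up ` B)" by auto
    then show ?thesis using fin by (intro bexI[of _ u]) auto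
  qed
  have two: "of_nat (2 * E) * v \<in> \<int>" if "of_nat E * v \<in> \<int>" for v :: real
    using Ints_add[OF that that] by (simp add: algebra_simps)
  consider "A = {}" "B = {}" | "A \<noteq> {}" "B = {}" | "A = {}" "B \<noteq> {}" | "A \<noteq> {}" "B \<noteq> {}"
    by blast
  then show ?thesis
  proof cases
    case 1
    then show ?thesis by (intro exI[of _ 0]) auto
  next
    case 2
    then obtain l where l: "l \<in> A" "\<And>l'. l' \<in> A \<Longrightarrow> lo l' \<le> lo l" using max by blast
    have "above (sl l') (lo l') (lo l + 1)" if "l' \<in> A" for l'
      using l(2)[OF that] by (auto simp: above_def)
    moreover have "of_nat E * (lo l + 1) \<in> \<int>"
      using E(1)[OF l(1)] by (simp add: distrib_left)
    ultimately show ?thesis using 2 two by blast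
  next
    case 3
    then obtain u where u: "u \<in> B" "\<And>u'. u' \<in> B \<Longrightarrow> up u \<le> up u'" using min by blast
    have "above (su u') (up u - 1) (up u')" if "u' \<in> B" for u'
      using u(2)[OF that] by (auto simp: above_def)
    moreover have "of_nat E * (up u - 1) \<in> \<int>"
      using E(2)[OF u(1)] by (simp add: right_diff_distrib)
    ultimately show ?thesis using 3 two by blast
  next
    case 4
    then obtain l u where l: "l \<in> A" "\<And>l'. l' \<in> A \<Longrightarrow> lo l' \<le> lo l"
      and u: "u \<in> B" "\<And>u'. u' \<in> B \<Longrightarrow> up u \<le> up u'" using max min by meson
    \<comment> \<open>A strict bound need not be the best one: for strict \<open>l'\<close> already
      \<open>lo l' \<le> lo l\<close> together with \<open>lo l' < up u\<close> places it strictly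
      below the midpoint. Upper bounds are symmetric.\<close>
    let ?v = "(lo l + up u) / 2"
    have "above (sl l') (lo l') ?v" if "l' \<in> A" for l'
      using l(2)[OF that] le[OF that u(1)] by (auto simp: above_def split: if_splits)
    moreover have "above (su u') ?v (up u')" if "u' \<in> B" for u'
      using u(2)[OF that] le[OF l(1) that] by (auto simp: above_def split: if_splits)
    moreover have "of_nat (2 * E) * ?v = of_nat E * lo l + of_nat E * up u"
      by (simp add: algebra_simps)
    then have "of_nat (2 * E) * ?v \<in> \<int>"
      using E l u by simp
    ultimately show ?thesis by blast
  qed
qed

lemma Ints_scale:
  assumes "of_nat D * v \<in> \<int>" "D dvd E"
  shows "of_nat E * (v :: real) \<in> \<int>"
proof -
  obtain k where "E = k * D" using assms(2) by (metis dvd_def mult.commute)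
  then have eq: "of_nat E * v = of_nat k * (of_nat D * v)" by simp
  show ?thesis unfolding eq by (intro Ints_mult[OF Ints_of_nat] assms(1))
qed

text \<open>\<open>fact K\<close> is a common multiple of all admissible divisors, so the factor
  does not depend on which one occurs.\<close>

lemma Ints_divide_fact:
  assumes "of_nat D * v \<in> \<int>" "0 < b" "b \<le> int K"
  shows "of_nat (fact K * D) * (v / of_int b :: real) \<in> \<int>"
proof -
  have "nat b dvd (fact K :: nat)"
    using assms by (intro dvd_fact) auto
  then obtain j where j: "(fact K :: nat) = nat b * j" by (auto simp: dvd_def)
  have "real (fact K) = real (nat b * j)" using j by (rule arg_cong)
  also have "\<dots> = of_int b * of_nat j" using assms(2) by simp
  finally have eq: "of_nat (fact K * D) * (v / of_int b) = of_nat j * (of_nat D * v)"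
    using assms(2) by simp
  show ?thesis unfolding eq by (intro Ints_mult[OF Ints_of_nat] assms(1))
qed

text \<open>Fourier--Motzkin elimination of the last variable.\<close>

lemma small_solution:
  assumes "finite S" "\<And>st c a i. (st, c, a) \<in> S \<Longrightarrow> \<bar>a i\<bar> \<le> int K"
    and "\<And>con. con \<in> S \<Longrightarrow> satisfies m z con"
  shows "\<exists>z'. (\<forall>con\<in>S. satisfies m z' con) \<and> (\<forall>i<m. of_nat (denominator m K) * z' i \<in> \<int>)"
  using assms
proof (induction m arbitrary: S K z)
  case 0
  then show ?case by (intro exI[of _ z]) simp
next
  case (Suc m)
  define A where "A = {(st, c, a) \<in> S. a m > 0}"
  define B where "B = {(st, c, a) \<in> S. a m < 0}"
  define Z where "Z = {(st, c, a) \<in> S. a m = 0}"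
  \<comment> \<open>Both multipliers, \<open>- b m\<close> and \<open>a m\<close>, are positive on
    \<open>A\<close> and \<open>B\<close>: directions are preserved, the coefficient of the last
    unknown cancels, and the sum is strict as soon as one summand is.\<close>
  define comb :: "lin_constraint \<times> lin_constraint \<Rightarrow> lin_constraint" where
    "comb = (\<lambda>((sl, c, a), (su, d, b)). (sl \<or> su, - b m * c + a m * d, \<lambda>i. - b m * a i + a m * b i))"
  define S' where "S' = Z \<union> comb ` (A \<times> B)"
  have fin: "finite A" "finite B" "finite Z"
    using Suc.prems(1) by (auto intro: finite_subset simp: A_def B_def Z_def)
  have "finite S'" using fin by (auto simp: S'_def)
  moreover have "\<bar>a i\<bar> \<le> int (2 * K * K)" if "(st, c, a) \<in> S'" for st c a i
  proof -
    from that consider "(st, c, a) \<in> Z" | "(st, c, a) \<in> comb ` (A \<times> B)"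
      unfolding S'_def by blast
    then show ?thesis
    proof cases
      case 1
      then have "\<bar>a i\<bar> \<le> int K" using Suc.prems(2) by (auto simp: Z_def)
      also have "K \<le> 2 * K * K" by (cases K) auto
      finally show ?thesis by simp
    next
      case 2
      then obtain l u where lu: "l \<in> A" "u \<in> B" "(st, c, a) = comb (l, u)" by blast
      obtain sl c1 a1 where l: "l = (sl, c1, a1)" by (cases l)
      obtain su c2 a2 where u: "u = (su, c2, a2)" by (cases u)
      have 1: "(sl, c1, a1) \<in> S" and 2: "(su, c2, a2) \<in> S"
        and a: "a = (\<lambda>i. - a2 m * a1 i + a1 m * a2 i)"
        using lu by (auto simp: l u comb_def A_def B_def)
      have "\<bar>a i\<bar> \<le> \<bar>a2 m\<bar> * \<bar>a1 i\<bar> + \<bar>a1 m\<bar> * \<bar>a2 i\<bar>"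
        unfolding a abs_mult[symmetric] by linarith
      also have "\<dots> \<le> int K * int K + int K * int K"
        using Suc.prems(2)[OF 1] Suc.prems(2)[OF 2] by (intro add_mono mult_mono) auto
      finally show ?thesis by simp
    qed
  qed
  moreover have "satisfies m z con" if "con \<in> S'" for con
  proof -
    from that consider "con \<in> Z" | "con \<in> comb ` (A \<times> B)"
      unfolding S'_def by blast
    then show ?thesis
    proof cases
      case 1
      then have "con \<in> S" by (auto simp: Z_def)
      from Suc.prems(3)[OF this] 1 show ?thesis
        by (cases con) (simp add: Z_def affine_Suc)
    next
      case 2
      then obtain l' u' where lu: "l' \<in> A" "u' \<in> B" "con = comb (l', u')" by blast
      obtain sl c a where l': "l' = (sl, c, a)" by (cases l')
      obtain su d b where u': "u' = (su, d, b)" by (cases u')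
      have l: "(sl, c, a) \<in> A" and u: "(su, d, b) \<in> B" and con: "con = comb ((sl, c, a), (su, d, b))"
        using lu l' u' by simp_all
      have S: "(sl, c, a) \<in> S" "0 < a m" "(su, d, b) \<in> S" "b m < 0"
        using l u by (auto simp: A_def B_def)
      from Suc.prems(3)[OF S(1)] Suc.prems(3)[OF S(3)]
      have "above sl 0 (affine m c a z + of_int (a m) * z m)" "above su 0 (affine m d b z + of_int (b m) * z m)"
        by (auto simp: affine_Suc)
      then have "above sl 0 (of_int (- b m) * (affine m c a z + of_int (a m) * z m))"
        "above su 0 (of_int (a m) * (affine m d b z + of_int (b m) * z m))"
        using S(2,4) by (auto simp: above_def zero_less_mult_iff mult_le_0_iff mult_less_0_iff zero_le_mult_iff split: if_splits)
      then have "above (sl \<or> su) 0 (of_int (- b m) * (affine m c a z + of_int (a m) * z m) +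
          of_int (a m) * (affine m d b z + of_int (b m) * z m))"
        by (auto simp: above_def split: if_splits)
      also have "of_int (- b m) * (affine m c a z + of_int (a m) * z m) +
          of_int (a m) * (affine m d b z + of_int (b m) * z m) =
          of_int (- b m) * affine m c a z + of_int (a m) * affine m d b z"
        by (simp add: algebra_simps)
      finally show ?thesis
        by (simp only: con comb_def prod.case satisfies.simps affine_combine)
    qed
  qed
  ultimately obtain z' where z': "\<And>con. con \<in> S' \<Longrightarrow> satisfies m z' con"
    "\<And>i. i < m \<Longrightarrow> of_nat (denominator m (2 * K * K)) * z' i \<in> \<int>"
    using Suc.IH[of S' "2 * K * K" z] by blast
  define D where "D = denominator m (2 * K * K)"
  \<comment> \<open>Solved for the last unknown, rows of \<open>A\<close> are lower bounds and rows
    of \<open>B\<close> upper bounds. A combined row in \<open>S'\<close>, divided by its positive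
    multipliers, says that one lower bound lies below one upper bound.\<close>
  define lo :: "lin_constraint \<Rightarrow> real" where
    "lo = (\<lambda>(st, c, a). - affine m c a z' / of_int (a m))"
  define up :: "lin_constraint \<Rightarrow> real" where
    "up = (\<lambda>(st, c, a). affine m c a z' / of_int (- a m))"
  have "\<exists>v. (\<forall>l\<in>A. above (fst l) (lo l) v) \<and> (\<forall>u\<in>B. above (fst u) v (up u)) \<and>
    of_nat (2 * (fact K * D)) * v \<in> \<int>"
  proof (rule intermediate_point)
    show "finite A" "finite B" using fin by auto
    fix l assume "l \<in> A"
    then obtain sl c a where l: "l = (sl, c, a)" "(sl, c, a) \<in> S" "0 < a m" and lA: "(sl, c, a) \<in> A"
      by (auto simp: A_def)
    have aff: "of_nat D * affine m c' a' z' \<in> \<int>" for c' a'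
      using z'(2) unfolding D_def by (rule affine_Ints)
    then have "of_nat D * (- affine m c a z') \<in> \<int>"
      by (simp only: mult_minus_right Ints_minus)
    then show "of_nat (fact K * D) * lo l \<in> \<int>"
      using l(3) Suc.prems(2)[OF l(2), of m] unfolding l(1) lo_def prod.case
      by (intro Ints_divide_fact) auto
    fix u assume "u \<in> B"
    then obtain su d b where u: "u = (su, d, b)" "(su, d, b) \<in> S" "b m < 0" and uB: "(su, d, b) \<in> B"
      by (auto simp: B_def)
    have "comb ((sl, c, a), (su, d, b)) \<in> S'"
      using lA uB unfolding S'_def by blast
    from z'(1)[OF this]
    have "above (sl \<or> su) 0 (of_int (- b m) * affine m c a z' + of_int (a m) * affine m d b z')"
      by (simp only: comb_def prod.case satisfies.simps affine_combine)
    then show "above (fst l \<or> fst u) (lo l) (up u)"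
      using l(3) u(3) by (auto simp: l(1) u(1) lo_def up_def above_def field_simps split: if_splits)
  next
    fix u assume "u \<in> B"
    then obtain su d b where u: "u = (su, d, b)" "(su, d, b) \<in> S" "b m < 0"
      by (auto simp: B_def)
    have "of_nat D * affine m d b z' \<in> \<int>"
      using z'(2) unfolding D_def by (rule affine_Ints)
    then show "of_nat (fact K * D) * up u \<in> \<int>"
      using u(3) Suc.prems(2)[OF u(2), of m] unfolding u(1) up_def prod.case
      by (intro Ints_divide_fact) auto
  qed
  then obtain v where v: "\<And>l. l \<in> A \<Longrightarrow> above (fst l) (lo l) v" "\<And>u. u \<in> B \<Longrightarrow> above (fst u) v (up u)"
    "of_nat (2 * (fact K * D)) * v \<in> \<int>" by blast
  let ?z = "z'(m := v)"
  have aff: "affine (Suc m) c a ?z = affine m c a z' + of_int (a m) * v" for c a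
    using affine_cong[of m ?z z' c a] by (simp add: affine_Suc)
  have "satisfies (Suc m) ?z con" if con: "con \<in> S" for con
  proof -
    obtain st c a where c: "con = (st, c, a)" by (cases con)
    consider "a m = 0" | "a m > 0" | "a m < 0" by linarith
    then show ?thesis
    proof cases
      case 1
      then have "con \<in> S'" using con c by (auto simp: S'_def Z_def)
      from z'(1)[OF this] 1 show ?thesis by (simp add: c aff)
    next
      case 2
      then have "con \<in> A" using con c by (auto simp: A_def)
      from v(1)[OF this] 2 show ?thesis
        by (auto simp: c aff lo_def above_def field_simps split: if_splits)
    next
      case 3
      then have "con \<in> B" using con c by (auto simp: B_def)
      from v(2)[OF this] 3 show ?thesis
        by (auto simp: c aff up_def above_def field_simps split: if_splits)
    qed
  qed
  moreover have "of_nat (denominator (Suc m) K) * ?z i \<in> \<int>" if "i < Suc m" for i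
  proof (cases "i = m")
    case True
    then show ?thesis using v(3) by (simp add: D_def mult.assoc)
  next
    case False
    with that have "of_nat D * z' i \<in> \<int>" unfolding D_def by (intro z'(2)) auto
    then have "of_nat (denominator (Suc m) K) * z' i \<in> \<int>"
      by (rule Ints_scale) (simp add: D_def)
    then show ?thesis using False by simp
  qed
  ultimately show ?case by blast
qed

text \<open>
  Each truncation is resolved according to the given point, which makes the term affine on the
  polyhedron of all points with the same outcomes.
\<close>

lemma linearize:
  assumes "\<And>i. i \<in> vars t \<Longrightarrow> g i < m"
  shows "\<exists>S c a. finite S \<and> (\<forall>con\<in>S. satisfies m z con) \<and>
    (\<forall>i. \<bar>a i\<bar> \<le> 2 ^ length (encode_term t)) \<and>
    (\<forall>(st, d, b)\<in>S. \<forall>i. \<bar>b i\<bar> \<le> 2 ^ length (encode_term t)) \<and>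
    (\<forall>z'. (\<forall>con\<in>S. satisfies m z' con) \<longrightarrow> interp t (z' \<circ> g) = affine m c a z')"
  using assms
proof (induction t)
  case (Var i)
  have "affine m 0 (\<lambda>j. if j = g i then 1 else 0) z' = z' (g i)" for z'
    using Var[of i] by (simp add: affine_def if_distrib[of of_int] if_distrib[of "\<lambda>x. x * _"] cong: if_cong)
  moreover have "(1 :: int) \<le> 2 * 2 ^ i"
    using one_le_power[of "2 :: int" i] by linarith
  ultimately show ?case
    by (intro exI[of _ "{}"] exI[of _ 0] exI[of _ "\<lambda>j. if j = g i then 1 else 0"]) auto
next
  case Zero
  show ?case
    by (intro exI[of _ "{}"] exI[of _ 0] exI[of _ "\<lambda>j. 0"]) (simp add: affine_def)
next
  case (Neg t)
  then have "\<And>i. i \<in> vars t \<Longrightarrow> g i < m" by simp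
  from Neg.IH[OF this] obtain S c a where IH: "finite S" "\<forall>con\<in>S. satisfies m z con"
    "\<forall>i. \<bar>a i\<bar> \<le> 2 ^ length (encode_term t)"
    "\<forall>(st, d, b)\<in>S. \<forall>i. \<bar>b i\<bar> \<le> 2 ^ length (encode_term t)"
    "\<forall>z'. (\<forall>con\<in>S. satisfies m z' con) \<longrightarrow> interp t (z' \<circ> g) = affine m c a z'"
    by blast
  have "affine m (1 - c) (\<lambda>i. - a i) z' = 1 - affine m c a z'" for z'
    by (simp add: affine_def sum_negf)
  then have val: "\<forall>z'. (\<forall>con\<in>S. satisfies m z' con) \<longrightarrow>
      interp (Neg t) (z' \<circ> g) = affine m (1 - c) (\<lambda>i. - a i) z'"
    using IH(5) by simp
  have le: "x \<le> 2 ^ length (encode_term (Neg t))" if "x \<le> 2 ^ length (encode_term t)" for x :: int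
    using that by (rule order_trans) simp
  have "\<forall>i. \<bar>- a i\<bar> \<le> 2 ^ length (encode_term (Neg t))"
    unfolding abs_minus_cancel using IH(3) le by blast
  moreover have "\<forall>(st, d, b)\<in>S. \<forall>i. \<bar>b i\<bar> \<le> 2 ^ length (encode_term (Neg t))"
    using IH(4) le by blast
  ultimately show ?case
    using IH(1,2) val
    by - (intro exI[of _ S] exI[of _ "1 - c"] exI[of _ "\<lambda>i. - a i"] conjI; assumption)
next
  case (Oplus s t)
  let ?L = "length (encode_term (Oplus s t))"
  \<comment> \<open>The letter \<open>OplusSym\<close> itself contributes a factor 2, which makes
    room for the sum of two coefficients.\<close>
  have le: "x + y \<le> 2 ^ ?L" if "x \<le> 2 ^ length (encode_term s)" "y \<le> 2 ^ length (encode_term t)" for x y :: int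
  proof -
    have "(2::int) ^ length (encode_term s) \<le> 2 ^ (length (encode_term s) + length (encode_term t))"
      "(2::int) ^ length (encode_term t) \<le> 2 ^ (length (encode_term s) + length (encode_term t))"
      by (auto intro: power_increasing)
    moreover have "(2::int) ^ ?L = 2 * 2 ^ (length (encode_term s) + length (encode_term t))"
      by simp
    ultimately show ?thesis using that by linarith
  qed
  have les: "x \<le> 2 ^ ?L" if "x \<le> 2 ^ length (encode_term s)" for x :: int
    using le[OF that, of 0] by simp
  have let': "x \<le> 2 ^ ?L" if "x \<le> 2 ^ length (encode_term t)" for x :: int
    using le[OF _ that, of 0] by simp
  have v: "\<And>i. i \<in> vars s \<Longrightarrow> g i < m" "\<And>i. i \<in> vars t \<Longrightarrow> g i < m"
    using Oplus.prems by simp_all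
  obtain S1 c1 a1 where 1: "finite S1" "\<forall>con\<in>S1. satisfies m z con"
    "\<forall>i. \<bar>a1 i\<bar> \<le> 2 ^ length (encode_term s)"
    "\<forall>(st, d, b)\<in>S1. \<forall>i. \<bar>b i\<bar> \<le> 2 ^ length (encode_term s)"
    "\<forall>z'. (\<forall>con\<in>S1. satisfies m z' con) \<longrightarrow> interp s (z' \<circ> g) = affine m c1 a1 z'"
    using Oplus.IH(1)[OF v(1)] by blast
  obtain S2 c2 a2 where 2: "finite S2" "\<forall>con\<in>S2. satisfies m z con"
    "\<forall>i. \<bar>a2 i\<bar> \<le> 2 ^ length (encode_term t)"
    "\<forall>(st, d, b)\<in>S2. \<forall>i. \<bar>b i\<bar> \<le> 2 ^ length (encode_term t)"
    "\<forall>z'. (\<forall>con\<in>S2. satisfies m z' con) \<longrightarrow> interp t (z' \<circ> g) = affine m c2 a2 z'"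
    using Oplus.IH(2)[OF v(2)] by blast
  have add: "affine m (c1 + c2) (\<lambda>i. a1 i + a2 i) z' = affine m c1 a1 z' + affine m c2 a2 z'" for z'
    using affine_combine[of m 1 c1 1 c2 a1 a2 z'] by simp
  have a12: "\<bar>a1 i + a2 i\<bar> \<le> 2 ^ ?L" for i
    using le[of "\<bar>a1 i\<bar>" "\<bar>a2 i\<bar>"] 1(3) 2(3) abs_triangle_ineq[of "a1 i" "a2 i"] order_trans by blast
  have S12: "\<forall>(st, d, b)\<in>S1 \<union> S2. \<forall>i. \<bar>b i\<bar> \<le> 2 ^ ?L"
    using 1(4) 2(4) les let' by blast
  have sum: "interp (Oplus s t) (z' \<circ> g) = min 1 (affine m (c1 + c2) (\<lambda>i. a1 i + a2 i) z')"
    if "\<forall>con\<in>S1 \<union> S2. satisfies m z' con" for z'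
  proof -
    have "interp s (z' \<circ> g) = affine m c1 a1 z'" "interp t (z' \<circ> g) = affine m c2 a2 z'"
      using that 1(5) 2(5) by blast+
    then show ?thesis by (simp add: add)
  qed
  have finish: ?case
    if con: "satisfies m z (st, d, b)" and b: "\<And>i. \<bar>b i\<bar> \<le> 2 ^ ?L" and a: "\<And>i. \<bar>a i\<bar> \<le> 2 ^ ?L"
      and eq: "\<And>z'. satisfies m z' (st, d, b) \<Longrightarrow>
        min 1 (affine m (c1 + c2) (\<lambda>i. a1 i + a2 i) z') = affine m c a z'" for st d b c a
  proof (intro exI conjI)
    let ?S = "insert (st, d, b) (S1 \<union> S2)"
    show "finite ?S" using 1(1) 2(1) by simp
    show "\<forall>con\<in>?S. satisfies m z con" using con 1(2) 2(2) by blast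
    show "\<forall>i. \<bar>a i\<bar> \<le> 2 ^ ?L" using a by blast
    show "\<forall>(st, d, b)\<in>?S. \<forall>i. \<bar>b i\<bar> \<le> 2 ^ ?L" using b S12 by blast
    show "\<forall>z'. (\<forall>con\<in>?S. satisfies m z' con) \<longrightarrow> interp (Oplus s t) (z' \<circ> g) = affine m c a z'"
    proof (intro allI impI)
      fix z' assume z': "\<forall>con\<in>?S. satisfies m z' con"
      show "interp (Oplus s t) (z' \<circ> g) = affine m c a z'"
        using sum[of z'] eq[of z'] z' by (metis (no_types, lifting) insert_iff)
    qed
  qed
  show ?case
  \<comment> \<open>Either outcome is recorded by a non-strict constraint. On the common boundary
    both affine forms have the value 1, so the overlap does no harm.\<close>
  proof (cases "affine m (c1 + c2) (\<lambda>i. a1 i + a2 i) z \<le> 1")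
    case True
    have con: "satisfies m z' (False, 1 - (c1 + c2), \<lambda>i. - (a1 i + a2 i)) \<longleftrightarrow>
        affine m (c1 + c2) (\<lambda>i. a1 i + a2 i) z' \<le> 1" for z'
      by (auto simp: above_def affine_def sum_negf sum_subtractf algebra_simps sum.distrib)
    show ?thesis
    proof (rule finish)
      show "satisfies m z (False, 1 - (c1 + c2), \<lambda>i. - (a1 i + a2 i))"
        using True unfolding con .
      show "\<bar>- (a1 i + a2 i)\<bar> \<le> 2 ^ ?L" for i
        unfolding abs_minus_cancel by (rule a12)
    qed (unfold con, use a12 in \<open>simp_all only: min_absorb2\<close>)
  next
    case False
    have con: "satisfies m z' (False, c1 + c2 - 1, \<lambda>i. a1 i + a2 i) \<longleftrightarrow>
        affine m (c1 + c2) (\<lambda>i. a1 i + a2 i) z' \<ge> 1" for z'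
      by (auto simp: above_def affine_def)
    have one: "affine m 1 (\<lambda>i. 0) z' = 1" for z'
      by (simp add: affine_def)
    show ?thesis
    proof (rule finish)
      show "satisfies m z (False, c1 + c2 - 1, \<lambda>i. a1 i + a2 i)"
        using False unfolding con by simp
      show "\<bar>0 :: int\<bar> \<le> 2 ^ ?L" by simp
      show "min 1 (affine m (c1 + c2) (\<lambda>i. a1 i + a2 i) z') = affine m 1 (\<lambda>i. 0) z'"
        if "satisfies m z' (False, c1 + c2 - 1, \<lambda>i. a1 i + a2 i)" for z'
        using that unfolding con one by simp
    qed (rule a12)
  qed
qed

section \<open>Terms in the finite MV-chain, and unseparated pairs of grid points\<close>

primrec chain_value :: "nat \<Rightarrow> (nat \<Rightarrow> nat) \<Rightarrow> mvterm \<Rightarrow> nat" where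
  "chain_value D p (Var i) = p i"
| "chain_value D p Zero = 0"
| "chain_value D p (Neg t) = D - chain_value D p t"
| "chain_value D p (Oplus s t) = min D (chain_value D p s + chain_value D p t)"

lemma chain_value_le: "(\<And>i. i \<in> vars t \<Longrightarrow> p i \<le> D) \<Longrightarrow> chain_value D p t \<le> D"
  by (induction t) auto

text \<open>The induction goes through because the grid of multiples of \<open>1 / D\<close> in the
  unit interval is closed under both connectives. For \<open>Neg\<close>,
  \<open>chain_value_le\<close> excludes truncation of the subtraction of naturals.\<close>

lemma interp_chain_value:
  assumes "0 < D" "\<And>i. i \<in> vars t \<Longrightarrow> p i \<le> D" "\<And>i. i \<in> vars t \<Longrightarrow> x i = p i / D"
  shows "interp t x = chain_value D p t / D"
  using assms(2,3)
proof (induction t)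
  case (Neg t)
  then have "chain_value D p t \<le> D" "interp t x = chain_value D p t / D"
    by (auto intro!: chain_value_le)
  then show ?case using assms(1) by (simp add: diff_divide_distrib)
next
  case (Oplus s t)
  then have "interp s x = chain_value D p s / D" "interp t x = chain_value D p t / D" by auto
  then have "interp s x + interp t x = real (chain_value D p s + chain_value D p t) / D"
    by (simp add: add_divide_distrib)
  then show ?case using assms(1) by (simp add: min_def le_divide_eq del: of_nat_add)
qed auto

text \<open>The two points are merged into one point \<open>z\<close>, with \<open>x\<close> on the
  even and \<open>y\<close> on the odd indices, so that a single linear system describes the pair.
  Its indices stay below \<open>2 * N + 2\<close>, and its coefficients are at most twice those of a
  term of length \<open>N\<close>; this gives the arguments of \<open>denominator\<close>.\<close>

lemma small_pair:
  assumes vars: "\<And>t. t \<in> set ts \<Longrightarrow> vars t \<subseteq> {1..n}"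
    and len: "n \<le> N" "\<And>t. t \<in> set ts \<Longrightarrow> length (encode_term t) \<le> N"
    and xy: "x \<in> cube n" "y \<in> cube n" "i0 \<in> {1..n}" "x i0 > y i0"
    and eq: "\<And>t. t \<in> set ts \<Longrightarrow> interp t x = interp t y"
    and D: "D = denominator (2 * N + 2) (2 ^ (N + 1))"
  shows "\<exists>p q. (\<forall>i\<in>{1..n}. p i \<le> D \<and> q i \<le> D) \<and> p i0 \<noteq> q i0 \<and>
    (\<forall>t\<in>set ts. chain_value D p t = chain_value D q t)"
proof -
  define m where "m = 2 * N + 2"
  let ?gx = "\<lambda>i. 2 * i" and ?gy = "\<lambda>i. 2 * i + 1"
  define z where "z j = (if even j then x (j div 2) else y (j div 2))" for j
  have zx: "z \<circ> ?gx = x" and zy: "z \<circ> ?gy = y" by (auto simp: z_def fun_eq_iff)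
  have ex: "\<exists>S. finite S \<and> (\<forall>con\<in>S. satisfies m z con) \<and>
      (\<forall>(st, d, b)\<in>S. \<forall>i. \<bar>b i\<bar> \<le> 2 ^ (N + 1)) \<and>
      (\<forall>z'. (\<forall>con\<in>S. satisfies m z' con) \<longrightarrow> interp t (z' \<circ> ?gx) = interp t (z' \<circ> ?gy))"
    if t: "t \<in> set ts" for t
  proof -
    have v: "?gx i < m" "?gy i < m" if "i \<in> vars t" for i
      using vars[OF t] that len(1) by (auto simp: m_def)
    have pow: "(2::int) ^ length (encode_term t) \<le> 2 ^ N"
      using len(2)[OF t] by (intro power_increasing) auto
    obtain S1 c1 a1 where 1: "finite S1" "\<forall>con\<in>S1. satisfies m z con"
      "\<forall>i. \<bar>a1 i\<bar> \<le> 2 ^ length (encode_term t)"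
      "\<forall>(st, d, b)\<in>S1. \<forall>i. \<bar>b i\<bar> \<le> 2 ^ length (encode_term t)"
      "\<forall>z'. (\<forall>con\<in>S1. satisfies m z' con) \<longrightarrow> interp t (z' \<circ> ?gx) = affine m c1 a1 z'"
      using linearize[of t ?gx m z] v(1) by blast
    obtain S2 c2 a2 where 2: "finite S2" "\<forall>con\<in>S2. satisfies m z con"
      "\<forall>i. \<bar>a2 i\<bar> \<le> 2 ^ length (encode_term t)"
      "\<forall>(st, d, b)\<in>S2. \<forall>i. \<bar>b i\<bar> \<le> 2 ^ length (encode_term t)"
      "\<forall>z'. (\<forall>con\<in>S2. satisfies m z' con) \<longrightarrow> interp t (z' \<circ> ?gy) = affine m c2 a2 z'"
      using linearize[of t ?gy m z] v(2) by blast
    \<comment> \<open>The equation between the two values becomes the two inequalities for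
      \<open>e = 1\<close> and \<open>e = -1\<close>. Subtracting rows bounded by
      \<open>2 ^ N\<close> is what raises the bound to \<open>2 ^ (N + 1)\<close>.\<close>
    define d where "d e = (False, e * c1 + - e * c2, \<lambda>i. e * a1 i + - e * a2 i)" for e :: int
    have d: "satisfies m z' (d e) \<longleftrightarrow> 0 \<le> of_int e * (affine m c1 a1 z' - affine m c2 a2 z')" for z' e
      using affine_combine[of m e c1 "-e" c2 a1 a2 z']
      by (simp add: d_def above_def right_diff_distrib)
    have "affine m c1 a1 z = affine m c2 a2 z"
      using 1(2,5) 2(2,5) eq[OF t] zx zy by metis
    then have "\<forall>con\<in>S1 \<union> S2 \<union> {d 1, d (-1)}. satisfies m z con"
      using 1(2) 2(2) d by (auto simp del: satisfies.simps)
    moreover have "\<forall>(st, d, b)\<in>S1 \<union> S2 \<union> {d 1, d (-1)}. \<forall>i. \<bar>b i\<bar> \<le> 2 ^ (N + 1)"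
    proof -
      have "\<bar>b i\<bar> \<le> 2 ^ (N + 1)" if "(st, d', b) \<in> S1 \<union> S2" for st d' b i
      proof -
        have "\<bar>b i\<bar> \<le> 2 ^ length (encode_term t)" using that 1(4) 2(4) by blast
        with pow have "\<bar>b i\<bar> \<le> 2 ^ N" by (rule order_trans[rotated])
        then show ?thesis by simp
      qed
      moreover have "\<bar>1 * a1 i + - 1 * a2 i\<bar> \<le> 2 ^ (N + 1)" "\<bar>- 1 * a1 i + - (- 1) * a2 i\<bar> \<le> 2 ^ (N + 1)" for i
      proof -
        have "\<bar>a1 i\<bar> \<le> 2 ^ N" "\<bar>a2 i\<bar> \<le> 2 ^ N"
          using 1(3) 2(3) pow order_trans by blast+
        then show "\<bar>1 * a1 i + - 1 * a2 i\<bar> \<le> 2 ^ (N + 1)" "\<bar>- 1 * a1 i + - (- 1) * a2 i\<bar> \<le> 2 ^ (N + 1)"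
          by simp_all
      qed
      ultimately show ?thesis unfolding d_def by blast
    qed
    moreover have "interp t (z' \<circ> ?gx) = interp t (z' \<circ> ?gy)"
      if "\<forall>con\<in>S1 \<union> S2 \<union> {d 1, d (-1)}. satisfies m z' con" for z'
    proof -
      have "affine m c1 a1 z' = affine m c2 a2 z'"
        using that d[of z' 1] d[of z' "-1"] by (auto simp del: satisfies.simps)
      then show ?thesis using that 1(5) 2(5) by auto
    qed
    ultimately show ?thesis
      using 1(1) 2(1) by (intro exI[of _ "S1 \<union> S2 \<union> {d 1, d (-1)}"]) auto
  qed
  from bchoice[OF ballI[OF this]] obtain S where S0: "\<forall>t\<in>set ts. finite (S t) \<and>
      (\<forall>con\<in>S t. satisfies m z con) \<and>
      (\<forall>(st, d, b)\<in>S t. \<forall>i. \<bar>b i\<bar> \<le> 2 ^ (N + 1)) \<and>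
      (\<forall>z'. (\<forall>con\<in>S t. satisfies m z' con) \<longrightarrow> interp t (z' \<circ> ?gx) = interp t (z' \<circ> ?gy))" ..
  have S: "finite (S t)" "\<And>con. con \<in> S t \<Longrightarrow> satisfies m z con"
    "\<And>st d b i. (st, d, b) \<in> S t \<Longrightarrow> \<bar>b i\<bar> \<le> 2 ^ (N + 1)"
    "\<And>z'. (\<And>con. con \<in> S t \<Longrightarrow> satisfies m z' con) \<Longrightarrow> interp t (z' \<circ> ?gx) = interp t (z' \<circ> ?gy)"
    if "t \<in> set ts" for t
    using bspec[OF S0 that] by blast+
  define unit :: "nat \<Rightarrow> nat \<Rightarrow> int" where "unit j = (\<lambda>i. if i = j then 1 else 0)" for j
  have unit: "affine m c (\<lambda>i. e * unit j i) z' = of_int c + of_int e * z' j" if "j < m" for c e j z'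
    using that by (simp add: affine_def unit_def if_distrib[of of_int] if_distrib[of "\<lambda>x. x * _"]
        if_distrib[of "\<lambda>x. _ * x"] cong: if_cong)
  define pos where "pos j = (False, 0 :: int, \<lambda>i. 1 * unit j i)" for j
  define le1 where "le1 j = (False, 1 :: int, \<lambda>i. -1 * unit j i)" for j
  define gap where "gap = (True, 0 :: int, \<lambda>i. 1 * unit (?gx i0) i + (-1) * unit (?gy i0) i)"
  have i0: "?gx i0 < m" "?gy i0 < m" using xy(3) len(1) by (auto simp: m_def)
  have pos: "satisfies m z' (pos j) \<longleftrightarrow> 0 \<le> z' j" and le1: "satisfies m z' (le1 j) \<longleftrightarrow> z' j \<le> 1"
    if "j < m" for j z'
    using unit[OF that, of 0 1] unit[OF that, of 1 "-1"] by (auto simp: pos_def le1_def above_def)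
  have gap: "satisfies m z' gap \<longleftrightarrow> z' (?gy i0) < z' (?gx i0)" for z'
    using affine_combine[of m 1 0 "-1" 0 "unit (?gx i0)" "unit (?gy i0)" z']
      unit[OF i0(1), of 0 1] unit[OF i0(2), of 0 1] by (simp add: gap_def above_def)
  \<comment> \<open>Coordinates are numbered from 1, so \<open>2 * i\<close> and
    \<open>2 * i + 1\<close> start at 2; the indices 0 and 1 carry no coordinate.\<close>
  define J where "J = {2..<2 * n + 2}"
  have J: "j < m" if "j \<in> J" for j using that len(1) by (auto simp: J_def m_def)
  define T where "T = \<Union> (S ` set ts) \<union> pos ` J \<union> le1 ` J \<union> {gap}"
  have "finite T" using S(1) by (auto simp: T_def J_def)
  moreover have "\<bar>a i\<bar> \<le> int (2 ^ (N + 1))" if "(st, c, a) \<in> T" for st c a i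
  proof -
    have "\<bar>unit (?gx i0) i - unit (?gy i0) i\<bar> \<le> 2 ^ (N + 1)" "\<bar>unit j i\<bar> \<le> 2 ^ (N + 1)" for j
      using one_le_power[of "2 :: int" "N + 1"] by (auto simp: unit_def)
    with that S(3) show ?thesis
      by (auto simp: T_def pos_def le1_def gap_def)
  qed
  moreover have "satisfies m z con" if "con \<in> T" for con
  proof -
    have zJ: "0 \<le> z j \<and> z j \<le> 1" if "j \<in> J" for j
    proof -
      have "j div 2 \<in> {1..n}" using that by (auto simp: J_def)
      then show ?thesis using xy(1,2) by (auto simp: z_def cube_def PiE_iff)
    qed
    have zgap: "satisfies m z gap" using gap xy(4) by (simp add: z_def)
    from that consider t where "t \<in> set ts" "con \<in> S t"
      | j where "j \<in> J" "con = pos j" | j where "j \<in> J" "con = le1 j" | "con = gap"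
      unfolding T_def by blast
    then show ?thesis
      by cases (use zJ zgap S(2) pos le1 J in \<open>simp_all del: satisfies.simps\<close>)
  qed
  ultimately obtain z' where z': "\<And>con. con \<in> T \<Longrightarrow> satisfies m z' con"
    "\<And>j. j < m \<Longrightarrow> of_nat D * z' j \<in> \<int>"
    using small_solution[of T "2 ^ (N + 1)" m z] unfolding D m_def by blast
  have Dpos: "0 < D" using D denominator_pos by simp
  \<comment> \<open>On \<open>J\<close> the floor is exact: there \<open>of_nat D * z' j\<close> is
    an integer between 0 and \<open>D\<close>.\<close>
  define r where "r j = nat \<lfloor>of_nat D * z' j\<rfloor>" for j
  have r: "z' j = r j / D \<and> r j \<le> D" if jJ: "j \<in> J" for j
  proof -
    have "0 \<le> z' j" "z' j \<le> 1"
      using z'(1)[of "pos j"] z'(1)[of "le1 j"] that pos le1 J by (auto simp: T_def simp del: satisfies.simps)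
    moreover obtain k where k: "of_nat D * z' j = of_int k"
      using z'(2)[OF J[OF jJ]] by (auto elim: Ints_cases)
    ultimately have "0 \<le> real_of_int k" "real_of_int k \<le> D"
      using Dpos by (auto simp flip: k simp: mult_left_le)
    then have k': "0 \<le> k" "k \<le> int D" by auto
    then have "real (r j) = of_int k" by (simp add: r_def k)
    then have "z' j = r j / D" using k Dpos by (simp add: field_simps)
    moreover have "r j \<le> D" using k' by (simp add: r_def k)
    ultimately show ?thesis ..
  qed
  have gJ: "?gx i \<in> J" "?gy i \<in> J" if "i \<in> {1..n}" for i
    using that by (auto simp: J_def)
  have "chain_value D (r \<circ> ?gx) t = chain_value D (r \<circ> ?gy) t" if t: "t \<in> set ts" for t
  proof -
    have "interp t (z' \<circ> ?gx) = chain_value D (r \<circ> ?gx) t / D"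
      "interp t (z' \<circ> ?gy) = chain_value D (r \<circ> ?gy) t / D"
      using vars[OF t] r gJ by (intro interp_chain_value[OF Dpos]; auto)+
    moreover have "interp t (z' \<circ> ?gx) = interp t (z' \<circ> ?gy)"
    proof (rule S(4)[OF t])
      show "satisfies m z' con" if "con \<in> S t" for con
        using that t by (intro z'(1)) (auto simp: T_def)
    qed
    ultimately show ?thesis using Dpos by simp
  qed
  moreover have "(r \<circ> ?gx) i0 \<noteq> (r \<circ> ?gy) i0"
  proof -
    have "z' (?gy i0) < z' (?gx i0)" using z'(1)[of gap] gap by (simp add: T_def)
    then show ?thesis using r gJ[OF xy(3)] by auto
  qed
  ultimately show ?thesis
    using r gJ by (intro exI[of _ "r \<circ> ?gx"] exI[of _ "r \<circ> ?gy"]) auto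
qed

text \<open>Grid points are points of the cube, which gives one direction; \<open>small_pair\<close>
  gives the other. Members of \<open>cube n\<close> are extensional, so distinct ones differ at an
  index in \<open>{1..n}\<close>, and the order of the values there is arranged by exchanging the
  points.\<close>

lemma separates_points_iff:
  assumes vars: "\<And>t. t \<in> set ts \<Longrightarrow> vars t \<subseteq> {1..n}"
    and N: "N = length (encode_instance n ts)"
    and D: "D = denominator (2 * N + 2) (2 ^ (N + 1))"
  shows "separates_points (interp ` set ts) (cube n) \<longleftrightarrow>
    (\<forall>p q. (\<forall>i\<in>{1..n}. p i \<le> D \<and> q i \<le> D) \<longrightarrow>
       (\<forall>t\<in>set ts. chain_value D p t = chain_value D q t) \<longrightarrow> (\<forall>i\<in>{1..n}. p i = q i))"
    (is "?L \<longleftrightarrow> ?R")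
proof
  assume L: ?L
  have Dpos: "0 < D" using D denominator_pos by simp
  show ?R
  proof (intro allI impI ballI)
    fix p q i assume le: "\<forall>i\<in>{1..n}. p i \<le> D \<and> q i \<le> D"
      and eq: "\<forall>t\<in>set ts. chain_value D p t = chain_value D q t" and i: "i \<in> {1..n}"
    define x where "x p = (\<lambda>i\<in>{1..n}. real (p i) / D)" for p :: "nat \<Rightarrow> nat"
    have x: "interp t (x p') = chain_value D p' t / D"
      if "t \<in> set ts" "\<forall>i\<in>{1..n}. p' i \<le> D" for t p'
      using vars[OF that(1)] that(2) by (intro interp_chain_value[OF Dpos]) (auto simp: x_def)
    have cube: "x p' \<in> cube n" if "\<forall>i\<in>{1..n}. p' i \<le> D" for p'
      using that Dpos by (auto simp: x_def cube_def)
    have "x p = x q"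
    proof (rule ccontr)
      assume "x p \<noteq> x q"
      then obtain t where "t \<in> set ts" "interp t (x p) \<noteq> interp t (x q)"
        using L cube le unfolding separates_points_def by blast
      then show False using x le eq by auto
    qed
    from fun_cong[OF this, of i] i Dpos show "p i = q i" by (simp add: x_def)
  qed
next
  assume R: ?R
  have n: "n \<le> N" by (simp add: N encode_instance_def)
  have len: "length (encode_term t) \<le> N" if "t \<in> set ts" for t
  proof -
    have "length (Comma # encode_term t) \<le> length (concat (map (\<lambda>t. Comma # encode_term t) ts))"
      using that by (induction ts) auto
    then show ?thesis by (simp add: N encode_instance_def)
  qed
  have no: False if "x \<in> cube n" "y \<in> cube n" "i \<in> {1..n}" "x i > y i"
      and "\<And>t. t \<in> set ts \<Longrightarrow> interp t x = interp t y" for x y i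
    using small_pair[OF vars n len that D] R that(3) by blast
  show ?L
    unfolding separates_points_def
  proof (intro ballI impI)
    fix x y assume xy: "x \<in> cube n" "y \<in> cube n" "x \<noteq> y"
    then obtain i where i: "i \<in> {1..n}" "x i \<noteq> y i"
      unfolding cube_def by (metis PiE_ext)
    show "\<exists>f\<in>interp ` set ts. f x \<noteq> f y"
    proof (rule ccontr)
      assume "\<not> ?thesis"
      then have "\<And>t. t \<in> set ts \<Longrightarrow> interp t x = interp t y" by auto
      then show False using no[OF xy(1,2) i(1)] no[OF xy(2,1) i(1)] i(2)
        by (metis linorder_neqE_linordered_idom)
    qed
  qed
qed

text \<open>\<open>denominator\<close> changes its parameter in the recursive call, whereas
  \<open>computable_rec\<close> keeps parameters fixed. Unfolded, it is a product over the iterates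
  of \<open>k\<close> to \<open>2 * k * k\<close>, that is, two nested recursions of the simple
  kind.\<close>

lemma denominator_rec:
  "denominator m K = rec_nat 1 (\<lambda>j x. 2 * fact (rec_nat K (\<lambda>_ k. 2 * k * k) j) * x) m"
proof -
  define f where "f K j = rec_nat K (\<lambda>_ k. 2 * k * k) j" for K j :: nat
  have f_Suc: "f (2 * K * K) j = f K (Suc j)" for K j
    by (induction j) (auto simp: f_def)
  have "rec_nat 1 (\<lambda>j x. 2 * fact (f K j) * x) m = (\<Prod>j<m. 2 * fact (f K j) :: nat)" for K m
    by (induction m) (auto simp: mult.commute)
  moreover have "denominator m K = (\<Prod>j<m. 2 * fact (f K j))" for K
  proof (induction m arbitrary: K)
    case (Suc m)
    have "(\<Prod>j<Suc m. 2 * fact (f K j)) = 2 * fact (f K 0) * (\<Prod>j<m. 2 * fact (f K (Suc j)))"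
      by (rule prod.lessThan_Suc_shift)
    also have "(\<Prod>j<m. 2 * fact (f K (Suc j))) = denominator m (2 * K * K)"
      unfolding Suc.IH f_Suc ..
    finally show ?case by (simp add: f_def)
  qed simp
  ultimately show ?thesis by (simp add: f_def)
qed

lemma computable_denominator [computable_intros]:
  assumes "computable t m" "computable t K"
  shows "computable t (\<lambda>e. denominator (m e) (K e))"
  unfolding denominator_rec
  using assms by - (intro computable_intros; (assumption | (erule computable_mono, assumption)))


section \<open>Deciding separation on words\<close>

primrec tally_run :: "letter list \<Rightarrow> nat" where
  "tally_run [] = 0"
| "tally_run (a # v) = (if a = Tally then Suc (tally_run v) else 0)"

lemma letter_at_simps [simp]:
  "letter_at [] x = None"
  "letter_at (a # v) 0 = Some a"
  "letter_at (a # v) (Suc x) = letter_at v x"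
  by (simp_all add: letter_at_def)

lemma letter_at_tally_run: "x \<le> tally_run v \<Longrightarrow> letter_at v x = Some Tally \<longleftrightarrow> x < tally_run v"
proof (induction v arbitrary: x)
  case (Cons a v)
  then show ?case by (cases x) (auto split: if_splits)
qed simp

lemma tally_run_le_length: "tally_run v \<le> length v"
  by (induction v) auto

text \<open>The pointer advances as long as it sees a tally and then rests, so \<open>m\<close>
  rounds give the minimum of \<open>m\<close> and the run; the length of the word is always enough
  rounds.\<close>

lemma tally_run_rec:
  "tally_run (drop i w) =
     rec_nat 0 (\<lambda>_ x. if letter_at w (i + x) = Some Tally then Suc x else x) (length w)"
proof -
  have "letter_at w (i + x) = letter_at (drop i w) x" for x
    by (auto simp: letter_at_def)
  then have "rec_nat 0 (\<lambda>_ x. if letter_at w (i + x) = Some Tally then Suc x else x) m =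
      min m (tally_run (drop i w))" for m
    by (induction m) (auto simp: letter_at_tally_run min_def)
  then show ?thesis
    using tally_run_le_length[of "drop i w"] by simp
qed

lemma computable_tally_run [computable_intros]:
  assumes "computable t i"
  shows "computable t (\<lambda>e. tally_run (drop (i e) (fst e)))"
  unfolding tally_run_rec
  using assms by - (intro computable_intros; (assumption | (erule computable_mono, assumption)))

text \<open>
  A stack of values in \<open>{0..D}\<close> is coded as a number in base \<open>D + 2\<close>, the value \<open>x\<close> being the
  digit \<open>x + 1\<close>, so that 0 codes only the empty stack.
\<close>

definition push :: "nat \<Rightarrow> nat \<Rightarrow> nat \<Rightarrow> nat" where
  "push D S x = Suc (S * (D + 2) + x)"

definition peek :: "nat \<Rightarrow> nat \<Rightarrow> nat" where
  "peek D S = S mod (D + 2) - 1"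

definition pop :: "nat \<Rightarrow> nat \<Rightarrow> nat" where
  "pop D S = S div (D + 2)"

lemma push_altdef: "push D S x = S * (D + 2) + Suc x"
  by (simp add: push_def)

lemma peek_push [simp]: "x \<le> D \<Longrightarrow> peek D (push D S x) = x"
  unfolding peek_def push_altdef mod_mult_self3 by simp

lemma pop_push [simp]: "x \<le> D \<Longrightarrow> pop D (push D S x) = S"
  unfolding pop_def push_altdef by (subst div_mult_self3) simp_all

lemma push_pos: "0 < push D S x"
  by (simp add: push_def)

text \<open>Comparison with \<open>D + 2\<close> distinguishes one entry from several, which is how
  arities are checked.\<close>

lemma push_less_iff: "x \<le> D \<Longrightarrow> push D S x < D + 2 \<longleftrightarrow> S = 0"
  by (cases S) (auto simp: push_def)

text \<open>The number \<open>P\<close> codes the point whose coordinates are its digits in base \<open>D + 1\<close>.\<close>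

definition coord :: "nat \<Rightarrow> nat \<Rightarrow> nat \<Rightarrow> nat" where
  "coord D P i = P div (D + 1) ^ (i - 1) mod (D + 1)"

lemma coord_le: "coord D P i \<le> D"
  unfolding coord_def using mod_less_divisor[of "D + 1"] by (simp add: less_Suc_eq_le)

lemma coord_exists: "\<exists>P<(D + 1) ^ n. \<forall>i\<in>{1..n}. coord D P i = p i" if "\<forall>i\<in>{1..n}. p i \<le> D"
  using that
proof (induction n arbitrary: p)
  case (Suc n)
  from Suc.prems have "\<forall>i\<in>{1..n}. p (Suc i) \<le> D" by simp
  from Suc.IH[OF this] obtain P where P: "P < (D + 1) ^ n" "\<forall>i\<in>{1..n}. coord D P i = p (Suc i)"
    by auto
  have p1: "p 1 < D + 1" using Suc.prems by (simp add: le_imp_less_Suc)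
  let ?P = "P * (D + 1) + p 1"
  have "?P < (P + 1) * (D + 1)" using p1 by simp
  also have "\<dots> \<le> (D + 1) ^ n * (D + 1)" using P(1) by (intro mult_right_mono) auto
  finally have "?P < (D + 1) ^ Suc n" by (simp add: mult.commute)
  moreover have "coord D ?P i = p i" if i: "i \<in> {1..Suc n}" for i
  proof (cases "i = 1")
    case True
    have "?P mod (D + 1) = p 1" using p1 unfolding mod_mult_self3 by simp
    with True show ?thesis by (simp add: coord_def)
  next
    case False
    with i obtain j where j: "i = Suc j" "j \<in> {1..n}" by (cases i) auto
    then obtain k where k: "j = Suc k" by (cases j) auto
    have "?P div (D + 1) ^ j = ?P div (D + 1) div (D + 1) ^ k"
      unfolding k power_Suc by (rule div_mult2_eq)
    also have "?P div (D + 1) = P" using p1 by (subst div_mult_self3) simp_all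
    finally have "coord D ?P i = coord D P j" by (simp add: coord_def j k)
    then show ?thesis using P(2) j by simp
  qed
  ultimately show ?case by blast
qed auto

text \<open>Allows the search to compare codes in place of points.\<close>

lemma coord_inject:
  assumes "P < (D + 1) ^ n" "Q < (D + 1) ^ n" "\<forall>i\<in>{1..n}. coord D P i = coord D Q i"
  shows "P = Q"
  using assms
proof (induction n arbitrary: P Q)
  case (Suc n)
  have div: "coord D R (Suc (Suc k)) = coord D (R div (D + 1)) (Suc k)" for R k
    unfolding coord_def by (simp only: diff_Suc_1 power_Suc div_mult2_eq)
  have "P div (D + 1) = Q div (D + 1)"
  proof (rule Suc.IH)
    show "P div (D + 1) < (D + 1) ^ n" "Q div (D + 1) < (D + 1) ^ n"
      using Suc.prems(1,2) by (auto simp: less_mult_imp_div_less mult.commute)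
    show "\<forall>i\<in>{1..n}. coord D (P div (D + 1)) i = coord D (Q div (D + 1)) i"
    proof
      fix i assume i: "i \<in> {1..n}"
      then obtain k where "i = Suc k" by (cases i) auto
      with i Suc.prems(3) div[of P k] div[of Q k] show "coord D (P div (D + 1)) i = coord D (Q div (D + 1)) i"
        by auto
    qed
  qed
  moreover have "P mod (D + 1) = Q mod (D + 1)"
    using Suc.prems(3) by (auto simp: coord_def dest: bspec[of _ _ 1])
  ultimately show ?case by (metis div_mult_mod_eq)
qed simp

text \<open>\<open>c\<close> is the length of the run of tallies to the right of the letter. Tallies
  therefore leave the stack alone, and \<open>VarSym\<close> finds its index ready. A comma falls
  under the last branch and empties the stack for the term to its left.\<close>

definition eval_letter :: "nat \<Rightarrow> nat \<Rightarrow> letter option \<Rightarrow> nat \<Rightarrow> nat \<Rightarrow> nat" where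
  "eval_letter D P a c S =
     (if a = Some Tally then S
      else if a = Some VarSym then push D S (coord D P c)
      else if a = Some ZeroSym then push D S 0
      else if a = Some NegSym then push D (pop D S) (D - peek D S)
      else if a = Some OplusSym then push D (pop D (pop D S)) (min D (peek D S + peek D (pop D S)))
      else 0)"

text \<open>Prefix notation is evaluated from right to left.\<close>

primrec stack :: "nat \<Rightarrow> nat \<Rightarrow> letter list \<Rightarrow> nat" where
  "stack D P [] = 0"
| "stack D P (a # v) = eval_letter D P (Some a) (tally_run v) (stack D P v)"

lemma drop_letter: "i < length w \<Longrightarrow> \<exists>a. letter_at w i = Some a \<and> drop i w = a # drop (Suc i) w"
  by (simp add: letter_at_def Cons_nth_drop_Suc)

text \<open>Recursion on the word becomes recursion on the number \<open>j\<close> of letters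
  already consumed at its right end.\<close>

lemma stack_rec:
  "stack D P (drop i w) = rec_nat 0 (\<lambda>j S. eval_letter D P (letter_at w (length w - Suc j))
     (tally_run (drop (length w - j) w)) S) (length w - i)"
proof -
  have "j \<le> length w \<Longrightarrow> stack D P (drop (length w - j) w) =
      rec_nat 0 (\<lambda>j S. eval_letter D P (letter_at w (length w - Suc j))
     (tally_run (drop (length w - j) w)) S) j" for j
  proof (induction j)
    case (Suc j)
    then have "length w - Suc j < length w" by simp
    from drop_letter[OF this] obtain a where "letter_at w (length w - Suc j) = Some a"
      "drop (length w - Suc j) w = a # drop (length w - j) w"
      using Suc.prems by (auto simp: Suc_diff_Suc)
    with Suc show ?case by simp
  qed simp
  from this[of "length w - i"] show ?thesis
    by (cases "i \<le> length w") simp_all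
qed

lemma computable_stack [computable_intros]:
  assumes "computable t D" "computable t P" "computable t i"
  shows "computable t (\<lambda>e. stack (D e) (P e) (drop (i e) (fst e)))"
  unfolding stack_rec eval_letter_def push_def pop_def peek_def coord_def
  using assms by - (intro computable_intros; (assumption | (erule computable_mono, assumption)))

primrec all_suffixes :: "(letter option \<Rightarrow> letter list \<Rightarrow> bool) \<Rightarrow> letter list \<Rightarrow> bool" where
  "all_suffixes R [] \<longleftrightarrow> True"
| "all_suffixes R (a # v) \<longleftrightarrow> R (Some a) v \<and> all_suffixes R v"

lemma all_suffixes_iff:
  "all_suffixes R w \<longleftrightarrow> (\<forall>i<length w. R (letter_at w i) (drop (Suc i) w))"
  by (induction w) (simp_all add: All_less_Suc2 letter_at_def)

text \<open>The evaluator doubles as a parser. The point coded by 0 is an arbitrary choice, as only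
  the depth of the stack matters: \<open>NegSym\<close> asks for at least one entry,
  \<open>OplusSym\<close> for at least two, \<open>Comma\<close> for exactly one. Tallies can follow
  only \<open>VarSym\<close> or other tallies, or open the word, where they give the
  dimension.\<close>

definition well_placed :: "nat \<Rightarrow> nat \<Rightarrow> letter option \<Rightarrow> letter list \<Rightarrow> bool" where
  "well_placed D n a v \<longleftrightarrow>
     (a = Some VarSym \<longrightarrow> 1 \<le> tally_run v \<and> tally_run v \<le> n) \<and>
     (\<not> a = Some VarSym \<longrightarrow> \<not> a = Some Tally \<longrightarrow> tally_run v = 0) \<and>
     (a = Some NegSym \<longrightarrow> 1 \<le> stack D 0 v) \<and>
     (a = Some OplusSym \<longrightarrow> D + 2 \<le> stack D 0 v) \<and>
     (a = Some Comma \<longrightarrow> 1 \<le> stack D 0 v \<and> stack D 0 v < D + 2)"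

text \<open>Right of a comma in an instance the stack consists of the value of one term, so equal
  stacks mean equal values.\<close>

definition agree :: "nat \<Rightarrow> nat \<Rightarrow> nat \<Rightarrow> letter option \<Rightarrow> letter list \<Rightarrow> bool" where
  "agree D P Q a v \<longleftrightarrow> (a = Some Comma \<longrightarrow> stack D P v = stack D Q v)"

text \<open>The condition that the final stack is empty excludes terms not preceded by a comma.
  \<open>drop 0 w\<close> has the shape required by \<open>computable_stack\<close>.\<close>

definition separating :: "nat \<Rightarrow> nat \<Rightarrow> letter list \<Rightarrow> bool" where
  "separating D n w \<longleftrightarrow> all_suffixes (well_placed D n) w \<and> stack D 0 (drop 0 w) = 0 \<and>
     (\<forall>P<(D + 1) ^ n. \<forall>Q<(D + 1) ^ n. all_suffixes (agree D P Q) w \<longrightarrow> P = Q)"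

lemma computable_separating:
  assumes "computable t D" "computable t n"
  shows "computable t (\<lambda>e. of_bool (separating (D e) (n e) (fst e)))"
  unfolding separating_def all_suffixes_iff well_placed_def agree_def
  using assms by - (intro computable_intros; (assumption | (erule computable_mono, (assumption | linarith))))

section \<open>Recognition of the words that code instances\<close>

abbreviation instance_tail :: "mvterm list \<Rightarrow> letter list" where
  "instance_tail ts \<equiv> concat (map (\<lambda>t. Comma # encode_term t) ts)"

lemma tally_run_encode_term [simp]: "tally_run (encode_term t @ v) = 0"
  by (cases t) auto

lemma tally_run_tail [simp]: "tally_run (instance_tail ts) = 0"
  by (cases ts) auto

lemma tally_run_replicate [simp]: "tally_run (replicate c Tally @ v) = c + tally_run v"
  by (induction c) auto

lemma stack_replicate [simp]: "stack D P (replicate c Tally @ v) = stack D P v"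
  by (induction c) (auto simp: eval_letter_def)

lemma stack_tail [simp]: "stack D P (instance_tail ts) = 0"
  by (cases ts) (auto simp: eval_letter_def)

lemma chain_value_coord_le: "chain_value D (coord D P) t \<le> D"
  by (rule chain_value_le) (rule coord_le)

text \<open>Tallies at the start of \<open>v\<close> would be taken for part of the index of a
  variable at the end of \<open>t\<close>; the hypothesis excludes this.\<close>

lemma stack_encode_term:
  "tally_run v = 0 \<Longrightarrow> stack D P (encode_term t @ v) = push D (stack D P v) (chain_value D (coord D P) t)"
  by (induction t arbitrary: v) (simp_all add: eval_letter_def chain_value_coord_le)

lemma all_suffixes_replicate:
  assumes "\<And>v. R (Some Tally) v"
  shows "all_suffixes R (replicate c Tally @ v) \<longleftrightarrow> all_suffixes R v"
  by (induction c) (auto simp: assms)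

lemma well_placed_encode_term:
  assumes "tally_run v = 0" "all_suffixes (well_placed D n) v" "vars t \<subseteq> {1..n}"
  shows "all_suffixes (well_placed D n) (encode_term t @ v)"
  using assms
proof (induction t arbitrary: v)
  case (Var i)
  then show ?case by (simp add: all_suffixes_replicate well_placed_def)
next
  case (Neg t)
  then show ?case using push_pos by (simp add: well_placed_def stack_encode_term Suc_le_eq)
next
  case (Oplus s t)
  have "stack D 0 (encode_term s @ encode_term t @ v) =
      push D (push D (stack D 0 v) (chain_value D (coord D 0) t)) (chain_value D (coord D 0) s)"
    using Oplus.prems(1) by (simp add: stack_encode_term)
  then have "\<not> stack D 0 (encode_term s @ encode_term t @ v) < D + 2"
    using push_less_iff[OF chain_value_coord_le] push_pos by (metis less_irrefl)
  then show ?case using Oplus by (simp add: well_placed_def not_less)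
qed (simp add: well_placed_def)

lemma well_placed_tail:
  "\<forall>t\<in>set ts. vars t \<subseteq> {1..n} \<Longrightarrow> all_suffixes (well_placed D n) (instance_tail ts)"
proof (induction ts)
  case (Cons t ts)
  have "stack D 0 (encode_term t @ instance_tail ts) < D + 2"
    using push_less_iff[OF chain_value_coord_le] by (simp add: stack_encode_term)
  then show ?case
    using Cons push_pos by (simp add: well_placed_encode_term)
      (simp add: well_placed_def stack_encode_term Suc_le_eq)
qed simp

text \<open>A suffix of an instance may begin in the middle of a term. It consists of tallies
  awaiting a \<open>VarSym\<close>, terms \<open>us\<close> awaiting a connective or a comma, and
  finished list items \<open>ts\<close>. Each further letter claims its arguments from the front of
  these, and \<open>well_placed\<close> says that they exist.\<close>

lemma parse:
  assumes "all_suffixes (well_placed D n) v"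
  shows "\<exists>c us ts. v = replicate c Tally @ concat (map encode_term us) @ instance_tail ts \<and>
    (\<forall>t\<in>set us \<union> set ts. vars t \<subseteq> {1..n})"
  using assms
proof (induction v)
  case Nil
  show ?case by (intro exI[of _ 0] exI[of _ "[]"]) simp
next
  case (Cons a v)
  then obtain c us ts where v: "v = replicate c Tally @ concat (map encode_term us) @ instance_tail ts"
    and vars: "\<forall>t\<in>set us \<union> set ts. vars t \<subseteq> {1..n}" by auto
  have wp: "well_placed D n (Some a) v" using Cons.prems by simp
  have run_us: "tally_run (concat (map encode_term us') @ instance_tail ts) = 0" for us'
    by (cases us') auto
  have run: "tally_run v = c" using run_us by (simp add: v)
  have stack: "stack D 0 (concat (map encode_term (u # us')) @ instance_tail ts) =
      push D (stack D 0 (concat (map encode_term us') @ instance_tail ts)) (chain_value D (coord D 0) u)" for u us'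
    using run_us by (simp add: stack_encode_term)
  note less = push_less_iff[OF chain_value_coord_le[of D 0]]
  show ?case
  proof (cases a)
    case Tally
    then show ?thesis
      using vars v by (intro exI[of _ "Suc c"] exI[of _ us] exI[of _ ts]) simp
  next
    case VarSym
    then have "c \<in> {1..n}" using wp run by (simp add: well_placed_def)
    with VarSym show ?thesis
      using vars v by (intro exI[of _ 0] exI[of _ "Var c # us"] exI[of _ ts]) simp
  next
    case ZeroSym
    then have "c = 0" using wp run by (simp add: well_placed_def)
    with ZeroSym show ?thesis
      using vars v by (intro exI[of _ 0] exI[of _ "Zero # us"] exI[of _ ts]) simp
  next
    case NegSym
    then have "c = 0" "us \<noteq> []" using wp run by (auto simp: well_placed_def v)
    then obtain u us' where "us = u # us'" by (cases us) auto
    with NegSym \<open>c = 0\<close> show ?thesis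
      using vars v by (intro exI[of _ 0] exI[of _ "Neg u # us'"] exI[of _ ts]) simp
  next
    case OplusSym
    then have c: "c = 0" and "\<not> stack D 0 v < D + 2"
      using wp run by (auto simp: well_placed_def)
    moreover have "stack D 0 (encode_term u @ instance_tail ts) < D + 2" for u
      using stack[of u "[]"] less by simp
    \<comment> \<open>\<open>remdups_adj.cases\<close> serves as the distinction between lists with
      no, one, and at least two entries; the depth test refutes the first two.\<close>
    ultimately have "\<exists>u u' us'. us = u # u' # us'"
      by (cases us rule: remdups_adj.cases) (auto simp: v)
    then obtain u u' us' where "us = u # u' # us'" by blast
    with OplusSym c show ?thesis
      using vars v by (intro exI[of _ 0] exI[of _ "Oplus u u' # us'"] exI[of _ ts]) simp
  next
    case Comma
    then have c: "c = 0" and lt: "stack D 0 v < D + 2" and "us \<noteq> []"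
      using wp run by (auto simp: well_placed_def v)
    then obtain u us' where us: "us = u # us'" by (cases us) auto
    with lt c have "stack D 0 (concat (map encode_term us') @ instance_tail ts) = 0"
      using stack less by (auto simp: v)
    then have "us' = []"
      using stack push_pos by (cases us') (auto, metis less_irrefl)
    with Comma c us show ?thesis
      using vars v by (intro exI[of _ 0] exI[of _ "[]"] exI[of _ "u # ts"]) simp
  qed
qed

text \<open>In the decomposition from \<open>parse\<close>, the empty final stack forces
  \<open>us = []\<close>. The remaining tallies in front are then the dimension, which is
  \<open>tally_run w\<close>.\<close>

lemma instance_iff:
  "all_suffixes (well_placed D (tally_run w)) w \<and> stack D 0 w = 0 \<longleftrightarrow>
     (\<exists>n ts. w = encode_instance n ts \<and> (\<forall>t\<in>set ts. vars t \<subseteq> {1..n}))" (is "?L \<longleftrightarrow> ?R")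
proof
  assume L: ?L
  then obtain c us ts where w: "w = replicate c Tally @ concat (map encode_term us) @ instance_tail ts"
    and vars: "\<forall>t\<in>set us \<union> set ts. vars t \<subseteq> {1..tally_run w}" using parse by blast
  have run_us: "tally_run (concat (map encode_term us') @ instance_tail ts) = 0" for us'
    by (cases us') auto
  have "us = []"
  proof (cases us)
    case (Cons u us')
    then have "stack D 0 w \<noteq> 0"
      using run_us push_pos by (simp add: w stack_encode_term)
    with L show ?thesis by simp
  qed
  then show ?R
    using w vars by (intro exI[of _ c] exI[of _ ts]) (simp add: encode_instance_def)
next
  assume ?R
  then obtain n ts where w: "w = encode_instance n ts" and "\<forall>t\<in>set ts. vars t \<subseteq> {1..n}" by blast
  from well_placed_tail[OF this(2), of D] show ?L
    by (simp add: w encode_instance_def all_suffixes_replicate well_placed_def[of _ _ "Some Tally"])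
qed

text \<open>A term contains no comma.\<close>

lemma all_suffixes_agree_encode_term:
  "all_suffixes (agree D P Q) (encode_term t @ v) \<longleftrightarrow> all_suffixes (agree D P Q) v"
  by (induction t arbitrary: v) (auto simp: agree_def all_suffixes_replicate)

lemma all_suffixes_agree_instance:
  "all_suffixes (agree D P Q) (encode_instance n ts) \<longleftrightarrow>
     (\<forall>t\<in>set ts. chain_value D (coord D P) t = chain_value D (coord D Q) t)"
proof -
  have "all_suffixes (agree D P Q) (instance_tail ts) \<longleftrightarrow>
     (\<forall>t\<in>set ts. chain_value D (coord D P) t = chain_value D (coord D Q) t)"
  proof (induction ts)
    case (Cons t ts)
    then show ?case
      by (simp add: all_suffixes_agree_encode_term)
        (simp add: agree_def stack_encode_term push_def)
  qed simp
  then show ?thesis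
    by (simp add: encode_instance_def all_suffixes_replicate agree_def)
qed

lemma chain_value_cong: "(\<And>i. i \<in> vars t \<Longrightarrow> p i = q i) \<Longrightarrow> chain_value D p t = chain_value D q t"
  by (induction t) auto

lemma separation_problem_iff:
  "w \<in> separation_problem \<longleftrightarrow>
     separating (denominator (2 * length w + 2) (2 ^ (length w + 1))) (tally_run (drop 0 w)) w"
proof -
  define D where "D = denominator (2 * length w + 2) (2 ^ (length w + 1))"
  have "separates_points (interp ` set ts) (cube n) \<longleftrightarrow>
      (\<forall>P<(D + 1) ^ n. \<forall>Q<(D + 1) ^ n. all_suffixes (agree D P Q) w \<longrightarrow> P = Q)"
    if w: "w = encode_instance n ts" and vars: "\<forall>t\<in>set ts. vars t \<subseteq> {1..n}" for n ts
  proof -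
    have iff: "separates_points (interp ` set ts) (cube n) \<longleftrightarrow>
      (\<forall>p q. (\<forall>i\<in>{1..n}. p i \<le> D \<and> q i \<le> D) \<longrightarrow>
         (\<forall>t\<in>set ts. chain_value D p t = chain_value D q t) \<longrightarrow> (\<forall>i\<in>{1..n}. p i = q i))"
      using separates_points_iff[of ts n "length w" D] vars w D_def by blast
    show ?thesis
      unfolding iff unfolding w all_suffixes_agree_instance
    proof (intro iffI allI impI)
      fix P Q
      assume sep: "\<forall>p q. (\<forall>i\<in>{1..n}. p i \<le> D \<and> q i \<le> D) \<longrightarrow>
         (\<forall>t\<in>set ts. chain_value D p t = chain_value D q t) \<longrightarrow> (\<forall>i\<in>{1..n}. p i = q i)"
        and PQ: "P < (D + 1) ^ n" "Q < (D + 1) ^ n"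
        and eq: "\<forall>t\<in>set ts. chain_value D (coord D P) t = chain_value D (coord D Q) t"
      have "\<forall>i\<in>{1..n}. coord D P i = coord D Q i"
        using sep eq coord_le by blast
      with PQ show "P = Q" by (rule coord_inject)
    next
      fix p q :: "nat \<Rightarrow> nat"
      assume inj: "\<forall>P<(D + 1) ^ n. \<forall>Q<(D + 1) ^ n.
          (\<forall>t\<in>set ts. chain_value D (coord D P) t = chain_value D (coord D Q) t) \<longrightarrow> P = Q"
        and le: "\<forall>i\<in>{1..n}. p i \<le> D \<and> q i \<le> D"
        and eq: "\<forall>t\<in>set ts. chain_value D p t = chain_value D q t"
      obtain P where P: "P < (D + 1) ^ n" "\<forall>i\<in>{1..n}. coord D P i = p i"
        using coord_exists[of n p D] le by blast
      obtain Q where Q: "Q < (D + 1) ^ n" "\<forall>i\<in>{1..n}. coord D Q i = q i"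
        using coord_exists[of n q D] le by blast
      have "chain_value D (coord D P) t = chain_value D (coord D Q) t" if t: "t \<in> set ts" for t
      proof -
        have "vars t \<subseteq> {1..n}" using vars t by blast
        then have "chain_value D (coord D P) t = chain_value D p t"
          "chain_value D (coord D Q) t = chain_value D q t"
          using P(2) Q(2) by (auto intro!: chain_value_cong)
        with eq t show ?thesis by simp
      qed
      then have "P = Q" using inj P(1) Q(1) by blast
      then show "\<forall>i\<in>{1..n}. p i = q i" using P(2) Q(2) by auto
    qed
  qed
  \<comment> \<open>The dimension of an instance can be read off as \<open>tally_run w\<close>, so
    the search condition no longer mentions \<open>n\<close> and \<open>ts\<close> and can leave the
    scope of the existential quantifier.\<close>
  then have "w \<in> separation_problem \<longleftrightarrow>
      (\<exists>n ts. w = encode_instance n ts \<and> (\<forall>t\<in>set ts. vars t \<subseteq> {1..n}) \<and>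
        (\<forall>P<(D + 1) ^ tally_run w. \<forall>Q<(D + 1) ^ tally_run w. all_suffixes (agree D P Q) w \<longrightarrow> P = Q))"
    unfolding separation_problem_def mem_Collect_eq
    by (intro arg_cong[where f = Ex] ext) (auto simp: encode_instance_def)
  also have "\<dots> \<longleftrightarrow> (\<exists>n ts. w = encode_instance n ts \<and> (\<forall>t\<in>set ts. vars t \<subseteq> {1..n})) \<and>
      (\<forall>P<(D + 1) ^ tally_run w. \<forall>Q<(D + 1) ^ tally_run w. all_suffixes (agree D P Q) w \<longrightarrow> P = Q)"
    by blast
  also have "\<dots> \<longleftrightarrow> separating D (tally_run (drop 0 w)) w"
    unfolding separating_def drop_0 instance_iff[symmetric, of w D] by (simp only: conj_assoc)
  finally show ?thesis unfolding D_def .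
qed

theorem theorem3p1: "turing_decidable separation_problem"
proof -
  have "computable 0 (\<lambda>e. of_bool (separating
      (denominator (2 * length (fst e) + 2) (2 ^ (length (fst e) + 1))) (tally_run (drop 0 (fst e))) (fst e)))"
    by (intro computable_separating computable_intros)
  from turing_decidable_computable[OF this]
  have "turing_decidable {w. of_bool (w \<in> separation_problem) \<noteq> (0 :: nat)}"
    unfolding separation_problem_iff .
  then show ?thesis by simp
qed

end
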